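(* Let $G=(V,E)$ be a complete graph with nonnegative metric edge costs $c$ and fixed vertices $s\neq t$. If the input to the randomized Christofides' algorithm is a half-integral feasible solution $x$ of (L.P.1), then the algorithm outputs a Hamiltonian $s$-$t$ path whose expected cost is at most $\frac32 c(x)$.
   Context: (L.P.1): minimize $\sum_{e\in E}c_ex_e$ subject to $x(\delta(s))=x(\delta(t))=1$; $x(\delta(v))=2$ for all $v\neq s,t$; $x(\delta(S))\ge1$ for every $s$-$t$ cut $S$ (i.e. $\emptyset\subsetneq S\subsetneq V$, $|S\cap\{s,t\}|=1$); $x(\delta(S))\ge2$ for every $\emptyset\subsetneq S\subsetneq V$ with $|S\cap\{s,t\}|$ even; $0\le x_e\le1$. Here $\delta(S)$ is the set of edges with exactly one end in $S$ and $x(D)=\sum_{e\in D}x_e$. Half-integral means every $x_e\in\{0,\tfrac12,1\}$. Every feasible solution of (L.P.1) lies in the spanning tree polytope of $G$. For a spanning tree $K$, its set of wrong degree vertices is $\{v\in\{s,t\}:\deg_K(v)\text{ even}\}\cup\{v\in V\setminus\{s,t\}:\deg_K(v)\text{ odd}\}$. For $T\subseteq V$, a $T$-join is an edge set $F$ whose set of odd-degree vertices is exactly $T$. Randomized Christofides' algorithm with input $x$: write $x=\sum_{i=1}^l\lambda_i\chi^{J_i}$ as a convex combination of incidence vectors of spanning trees $J_i$ ($\lambda_i>0$, $\sum\lambda_i=1$); sample $J=J_i$ with probability $\lambda_i$; let $T$ be the set of wrong degree vertices of $J$ and $F$ a minimum-cost $T$-join; take an Eulerian $s$-$t$ trail in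 the multigraph $J\dot\cup F$ and shortcut it to a Hamiltonian $s$-$t$ path (of cost at most $c(J)+c(F)$). *)

theory Defs
  imports "HOL-Probability.Probability"
begin

subsection \<open>Undirected graphs on a vertex set, with edges as two-element sets\<close>

definition complete_edges :: "'a set \<Rightarrow> 'a set set" where
  "complete_edges V = {e. e \<subseteq> V \<and> card e = 2}"

text \<open>Edges of the complete graph with exactly one end in \<open>S\<close>.\<close>

definition cut :: "'a set \<Rightarrow> 'a set \<Rightarrow> 'a set set" where
  "cut V S = {e \<in> complete_edges V. card (e \<inter> S) = 1}"

definition degree :: "'a set set \<Rightarrow> 'a \<Rightarrow> nat" where
  "degree K v = card {e \<in> K. v \<in> e}"

definition connects :: "'a set \<Rightarrow> 'a set set \<Rightarrow> bool" where
  "connects V K \<longleftrightarrow> (\<forall>u\<in>V. \<forall>v\<in>V. (u, v) \<in> {(a, b). {a, b} \<in> K}\<^sup>*)"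

text \<open>The edges traversed by a walk that is given by its sequence of vertices.\<close>

definition walk_edges :: "'a list \<Rightarrow> 'a set list" where
  "walk_edges W = map (\<lambda>(u, v). {u, v}) (zip W (tl W))"

text \<open>A cycle is given by its distinct vertices in cyclic order, without repeating the first one.\<close>

definition is_cycle :: "'a set set \<Rightarrow> 'a list \<Rightarrow> bool" where
  "is_cycle K C \<longleftrightarrow> length C \<ge> 3 \<and> distinct C \<and> set (walk_edges (C @ [hd C])) \<subseteq> K"

definition spanning_tree :: "'a set \<Rightarrow> 'a set set \<Rightarrow> bool" where
  "spanning_tree V K \<longleftrightarrow> K \<subseteq> complete_edges V \<and> connects V K \<and> (\<nexists>C. is_cycle K C)"

definition hamiltonian_path :: "'a set \<Rightarrow> 'a \<Rightarrow> 'a \<Rightarrow> 'a list \<Rightarrow> bool" where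
  "hamiltonian_path V s t P \<longleftrightarrow> P \<noteq> [] \<and> hd P = s \<and> last P = t \<and> distinct P \<and> set P = V"


subsection \<open>Costs\<close>

text \<open>The triangle inequality is only required for distinct vertices, since \<open>{u, u}\<close> is not an edge.\<close>

definition metric_costs :: "'a set \<Rightarrow> ('a set \<Rightarrow> real) \<Rightarrow> bool" where
  "metric_costs V c \<longleftrightarrow>
     (\<forall>e\<in>complete_edges V. 0 \<le> c e) \<and>
     (\<forall>u\<in>V. \<forall>v\<in>V. \<forall>w\<in>V. u \<noteq> v \<and> v \<noteq> w \<and> u \<noteq> w \<longrightarrow> c {u, w} \<le> c {u, v} + c {v, w})"

definition path_cost :: "('a set \<Rightarrow> real) \<Rightarrow> 'a list \<Rightarrow> real" where
  "path_cost c P = sum_list (map c (walk_edges P))"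

definition fractional_cost :: "'a set \<Rightarrow> ('a set \<Rightarrow> real) \<Rightarrow> ('a set \<Rightarrow> real) \<Rightarrow> real" where
  "fractional_cost V c x = (\<Sum>e\<in>complete_edges V. c e * x e)"


subsection \<open>The linear program for the \<open>s\<close>-\<open>t\<close> path problem\<close>

definition lp_feasible :: "'a set \<Rightarrow> 'a \<Rightarrow> 'a \<Rightarrow> ('a set \<Rightarrow> real) \<Rightarrow> bool" where
  "lp_feasible V s t x \<longleftrightarrow>
     sum x (cut V {s}) = 1 \<and> sum x (cut V {t}) = 1 \<and>
     (\<forall>v\<in>V - {s, t}. sum x (cut V {v}) = 2) \<and>
     (\<forall>S. S \<noteq> {} \<and> S \<subset> V \<and> card (S \<inter> {s, t}) = 1 \<longrightarrow> sum x (cut V S) \<ge> 1) \<and>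
     (\<forall>S. S \<noteq> {} \<and> S \<subset> V \<and> even (card (S \<inter> {s, t})) \<longrightarrow> sum x (cut V S) \<ge> 2) \<and>
     (\<forall>e\<in>complete_edges V. 0 \<le> x e \<and> x e \<le> 1)"

definition half_integral :: "'a set \<Rightarrow> ('a set \<Rightarrow> real) \<Rightarrow> bool" where
  "half_integral V x \<longleftrightarrow> (\<forall>e\<in>complete_edges V. x e \<in> {0, 1/2, 1})"


subsection \<open>Randomized Christofides' algorithm\<close>

definition wrong_degree :: "'a set \<Rightarrow> 'a \<Rightarrow> 'a \<Rightarrow> 'a set set \<Rightarrow> 'a set" where
  "wrong_degree V s t K =
     {v \<in> {s, t}. even (degree K v)} \<union> {v \<in> V - {s, t}. odd (degree K v)}"

definition T_join :: "'a set \<Rightarrow> 'a set \<Rightarrow> 'a set set \<Rightarrow> bool" where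
  "T_join V T F \<longleftrightarrow> F \<subseteq> complete_edges V \<and> {v \<in> V. odd (degree F v)} = T"

definition min_cost_T_join :: "'a set \<Rightarrow> ('a set \<Rightarrow> real) \<Rightarrow> 'a set \<Rightarrow> 'a set set \<Rightarrow> bool" where
  "min_cost_T_join V c T F \<longleftrightarrow> T_join V T F \<and> (\<forall>F'. T_join V T F' \<longrightarrow> sum c F \<le> sum c F')"

text \<open>A multigraph is a multiset of edges; the trail uses each edge as often as it occurs there.\<close>

definition eulerian_trail :: "'a \<Rightarrow> 'a \<Rightarrow> 'a set multiset \<Rightarrow> 'a list \<Rightarrow> bool" where
  "eulerian_trail s t M W \<longleftrightarrow> W \<noteq> [] \<and> hd W = s \<and> last W = t \<and> mset (walk_edges W) = M"

text \<open>Skip one interior visit to a vertex that is also visited at some other point of the walk.\<close>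

inductive shortcut_step :: "'a list \<Rightarrow> 'a list \<Rightarrow> bool" where
  "\<lbrakk>xs \<noteq> []; ys \<noteq> []; v \<in> set (xs @ ys)\<rbrakk> \<Longrightarrow> shortcut_step (xs @ v # ys) (xs @ ys)"

text \<open>\<open>P\<close> results from \<open>W\<close> by shortcutting, in any order, for as long as this is possible.\<close>

definition shortcut :: "'a list \<Rightarrow> 'a list \<Rightarrow> bool" where
  "shortcut W P \<longleftrightarrow> shortcut_step\<^sup>*\<^sup>* W P \<and> (\<nexists>P'. shortcut_step P P')"

definition tree_decomposition ::
    "'a set \<Rightarrow> ('a set \<Rightarrow> real) \<Rightarrow> nat \<Rightarrow> (nat \<Rightarrow> real) \<Rightarrow> (nat \<Rightarrow> 'a set set) \<Rightarrow> bool" where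
  "tree_decomposition V x l lam J \<longleftrightarrow>
     (\<forall>i\<in>{1..l}. lam i > 0 \<and> spanning_tree V (J i)) \<and> (\<Sum>i=1..l. lam i) = 1 \<and>
     (\<forall>e\<in>complete_edges V. x e = (\<Sum>i=1..l. lam i * indicator (J i) e))"

text \<open>The possible results \<open>P\<close> once the spanning tree \<open>K\<close> has been sampled.\<close>

definition christofides_path ::
    "'a set \<Rightarrow> ('a set \<Rightarrow> real) \<Rightarrow> 'a \<Rightarrow> 'a \<Rightarrow> 'a set set \<Rightarrow> 'a list \<Rightarrow> bool" where
  "christofides_path V c s t K P \<longleftrightarrow>
     (\<exists>F W. min_cost_T_join V c (wrong_degree V s t K) F \<and>
            eulerian_trail s t (mset_set K + mset_set F) W \<and> shortcut W P)"

text \<open>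
  The algorithm leaves the choice of the decomposition, the \<open>T\<close>-joins, the trails and the shortcuts
  open. Hence its semantics is a relation: \<open>Q\<close> is the distribution of the output for one way of
  making these choices. The result is \<open>P i\<close> with probability \<open>lam i\<close>; the paths \<open>P i\<close> need not be
  distinct, in which case \<^const>\<open>pmf_of_list\<close> adds up the probabilities.
\<close>

definition randomized_christofides ::
    "'a set \<Rightarrow> ('a set \<Rightarrow> real) \<Rightarrow> 'a \<Rightarrow> 'a \<Rightarrow> ('a set \<Rightarrow> real) \<Rightarrow> 'a list pmf \<Rightarrow> bool" where
  "randomized_christofides V c s t x Q \<longleftrightarrow>
     (\<exists>l lam J P. tree_decomposition V x l lam J \<and>
        (\<forall>i\<in>{1..l}. christofides_path V c s t (J i) (P i)) \<and>
        Q = pmf_of_list (map (\<lambda>i. (P i, lam i)) [1..<Suc l]))"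

end

theory Submission
  imports Defs
begin

text \<open>
  On an \<open>s\<close>-\<open>t\<close> cut, a half-integral solution \<open>x\<close> takes an integral value. If this value is 1, every
  tree of the decomposition crosses the cut exactly once, and then the cut contains an even number
  of wrong degree vertices. Hence all cuts that separate an odd number of wrong degree vertices
  have value at least 2, so \<open>x/2\<close> lies in the dominant of the \<open>T\<close>-join polytope of every tree, and
  each \<open>T\<close>-join costs at most \<open>c(x)/2\<close>. The trees cost \<open>c(x)\<close> on average.
\<close>

subsection \<open>Cuts, degrees and joins\<close>

text \<open>The degrees of a tree summed over \<open>S\<close> have the parity of its number of
  edges in \<delta>(S), and the wrong degree vertices arise from the odd degree vertices by toggling
  \<open>s\<close> and \<open>t\<close>. Hence an \<open>s\<close>-\<open>t\<close> cut crossed once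
  has an even number of wrong degree vertices on each side. Cuts with both or neither of
  \<open>s\<close>, \<open>t\<close> inside have value at least 2 by the linear program itself, so
  half-integrality is needed on \<open>s\<close>-\<open>t\<close> cuts only. Two polyhedral facts
  carry the rest. Both are proved by lowering costs between components of the zero cost edges. For
  joins this is done with natural costs under which all cycles have even cost: a strict gain along a
  cycle is then at least 2, which pays for two edges of a cut. Real costs follow by scaling and
  rounding. That \<open>x\<close> is a convex combination of spanning trees guarantees that the
  algorithm has a run at all; the cost bound holds for every run, whatever trees, joins, trails and
  shortcuts it chooses.\<close>

abbreviation adj :: "'a set set \<Rightarrow> ('a \<times> 'a) set" where
  "adj K \<equiv> {(a, b). {a, b} \<in> K}"

lemma finite_complete_edges [simp]: "finite V \<Longrightarrow> finite (complete_edges V)"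
  by (rule finite_subset[of _ "Pow V"]) (auto simp: complete_edges_def)

lemma complete_edgesE:
  assumes "e \<in> complete_edges V"
  obtains u v where "e = {u, v}" "u \<noteq> v" "u \<in> V" "v \<in> V"
  using assms by (auto simp: complete_edges_def card_2_iff)

lemma doubleton_in_complete_edges [simp]:
  "{u, v} \<in> complete_edges V \<longleftrightarrow> u \<noteq> v \<and> u \<in> V \<and> v \<in> V"
  by (auto simp: complete_edges_def card_2_iff)

lemma singleton_not_edge [simp]: "{u} \<notin> complete_edges V"
  by (simp add: complete_edges_def)

lemma doubleton_in_cut [simp]:
  "{u, v} \<in> cut V S \<longleftrightarrow> u \<in> V \<and> v \<in> V \<and> (u \<in> S) \<noteq> (v \<in> S)"
proof (cases "u = v")
  case False
  then show ?thesis by (cases "u \<in> S"; cases "v \<in> S") (auto simp: cut_def)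
qed (simp add: cut_def)

lemma cutE:
  assumes "e \<in> cut V S"
  obtains u v where "e = {u, v}" "u \<in> S" "v \<notin> S" "u \<in> V" "v \<in> V"
proof -
  have "e \<in> complete_edges V" using assms by (auto simp: cut_def)
  then obtain u v where e: "e = {u, v}" "u \<noteq> v" "u \<in> V" "v \<in> V" by (rule complete_edgesE)
  show ?thesis
  proof (cases "u \<in> S")
    case True
    then show ?thesis using that[of u v] assms e by auto
  next
    case False
    then show ?thesis using that[of v u] assms e by (auto simp: insert_commute)
  qed
qed

lemma cut_subset: "cut V S \<subseteq> complete_edges V"
  by (auto simp: cut_def)

lemma cut_singleton: "v \<in> V \<Longrightarrow> cut V {v} = {e \<in> complete_edges V. v \<in> e}"
  by (auto simp: cut_def Int_insert_right)

lemma card_edge_Int: "e \<in> complete_edges V \<Longrightarrow> 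
  card (e \<inter> S) = (if e \<in> cut V S then 1 else if e \<subseteq> S then 2 else 0)"
  by (erule complete_edgesE) (auto simp: Int_insert_left)

text \<open>Swapping the order of summation. With \<open>f\<close> constantly 1 it gives the parity
  of cuts, with \<open>f = x\<close> the relation between degrees and cuts in the linear
  program.\<close>

lemma sum_incident_edges:
  fixes f :: "'a set \<Rightarrow> 'b::comm_semiring_1"
  assumes "finite V" "S \<subseteq> V" "F \<subseteq> complete_edges V"
  shows "(\<Sum>v\<in>S. \<Sum>e\<in>{e\<in>F. v \<in> e}. f e) = (\<Sum>e\<in>F. of_nat (card (e \<inter> S)) * f e)"
proof -
  have fin: "finite S" "finite F"
    using assms finite_subset finite_complete_edges by metis+
  have "(\<Sum>v\<in>S. \<Sum>e\<in>{e\<in>F. v \<in> e}. f e) = (\<Sum>e\<in>F. \<Sum>v\<in>{v\<in>S. v \<in> e}. f e)"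
    using fin by (rule sum.swap_restrict)
  also have "\<dots> = (\<Sum>e\<in>F. of_nat (card (e \<inter> S)) * f e)"
    by (intro sum.cong) (auto simp: Int_def conj_commute)
  finally show ?thesis .
qed

text \<open>Edges inside \<open>S\<close> are counted twice and edges of the cut once, so only the
  latter matter modulo 2.\<close>

lemma sum_degree_parity:
  assumes "finite V" "S \<subseteq> V" "F \<subseteq> complete_edges V"
  shows "even (\<Sum>v\<in>S. degree F v) \<longleftrightarrow> even (card (F \<inter> cut V S))"
proof -
  have fin: "finite F" using assms finite_subset finite_complete_edges by metis
  have "(\<Sum>v\<in>S. degree F v) = (\<Sum>e\<in>F. card (e \<inter> S))"
    using sum_incident_edges[OF assms, of "\<lambda>_. 1::nat"] by (simp add: degree_def)
  moreover have "{e \<in> F. odd (card (e \<inter> S))} = F \<inter> cut V S"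
    using assms(3) by (auto simp: card_edge_Int subset_iff split: if_splits)
  ultimately show ?thesis using fin by (simp add: even_sum_iff)
qed

lemma T_join_cut_parity:
  assumes "finite V" "T_join V T F" "S \<subseteq> V"
  shows "even (card (F \<inter> cut V S)) \<longleftrightarrow> even (card (S \<inter> T))"
proof -
  have "{v \<in> S. odd (degree F v)} = S \<inter> T" using assms by (auto simp: T_join_def)
  moreover have "finite S" using assms finite_subset by blast
  ultimately have "even (\<Sum>v\<in>S. degree F v) \<longleftrightarrow> even (card (S \<inter> T))"
    by (simp add: even_sum_iff)
  then show ?thesis using sum_degree_parity[of V S F] assms by (auto simp: T_join_def)
qed

section \<open>Joins modulo 2 and joins along paths\<close>

lemma even_card_sym_diff:
  assumes "finite A" "finite B"
  shows "even (card (sym_diff A B)) \<longleftrightarrow> (even (card A) \<longleftrightarrow> even (card B))"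
proof -
  have "card A = card (A - B) + card (A \<inter> B)" "card B = card (B - A) + card (A \<inter> B)"
    using assms card_Int_Diff[of A B] card_Int_Diff[of B A] by (auto simp: Int_commute)
  moreover have "card (sym_diff A B) = card (A - B) + card (B - A)"
    using assms by (intro card_Un_disjoint) auto
  ultimately show ?thesis by auto
qed

text \<open>Sets of odd degree vertices add modulo 2. All later exchanges of paths and cycles are
  computed this way; a cycle appears as a join for the empty set.\<close>

lemma T_join_sym_diff:
  assumes "finite V" "T_join V T F" "T_join V U G"
  shows "T_join V (sym_diff T U) (sym_diff F G)"
proof -
  have fin: "finite F" "finite G"
    using assms finite_subset finite_complete_edges unfolding T_join_def by metis+
  have "even (degree (sym_diff F G) v) \<longleftrightarrow> (even (degree F v) \<longleftrightarrow> even (degree G v))" for v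
  proof -
    have "{e \<in> sym_diff F G. v \<in> e} = sym_diff {e \<in> F. v \<in> e} {e \<in> G. v \<in> e}" by auto
    then show ?thesis using fin by (simp only: degree_def) (rule even_card_sym_diff, auto)
  qed
  then show ?thesis using assms unfolding T_join_def by blast
qed

lemma T_join_empty: "T_join V {} {}"
  by (simp add: T_join_def degree_def)

lemma T_join_edge:
  assumes "e = {u, v}" "u \<noteq> v" "u \<in> V" "v \<in> V"
  shows "T_join V (sym_diff {u} {v}) {e}"
proof -
  have "degree {e} w = (if w = u \<or> w = v then 1 else 0)" for w
  proof -
    have "{f \<in> {e}. w \<in> f} = (if w = u \<or> w = v then {e} else {})" using assms by auto
    then show ?thesis by (simp add: degree_def)
  qed
  then show ?thesis using assms by (auto simp: T_join_def)
qed

lemma sym_adj_rtrancl: "(u, v) \<in> (adj K)\<^sup>* \<Longrightarrow> (v, u) \<in> (adj K)\<^sup>*"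
proof -
  have "sym ((adj K)\<^sup>*)" by (intro sym_rtrancl) (auto simp: sym_def insert_commute)
  then show "(u, v) \<in> (adj K)\<^sup>* \<Longrightarrow> (v, u) \<in> (adj K)\<^sup>*" by (auto dest: symD)
qed

lemma adj_rtrancl_Image_subset:
  assumes "\<And>a b. {a, b} \<in> K \<Longrightarrow> a \<in> A \<Longrightarrow> b \<in> A" "u \<in> A"
  shows "(adj K)\<^sup>* `` {u} \<subseteq> A"
proof
  fix v assume "v \<in> (adj K)\<^sup>* `` {u}"
  then have "(u, v) \<in> (adj K)\<^sup>*" by simp
  then show "v \<in> A" by induction (use assms in auto)
qed

text \<open>The edges of a walk are added modulo 2, so repeated edges cancel and no simple path has
  to be extracted. Writing the ends as \<open>sym_diff {u} {v}\<close> covers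
  \<open>u = v\<close>.\<close>

lemma path_join:
  assumes "finite V" "K \<subseteq> complete_edges V" "(u, v) \<in> (adj K)\<^sup>*"
  shows "\<exists>P\<subseteq>K. T_join V (sym_diff {u} {v}) P"
  using assms(3)
proof induction
  case base
  then show ?case using T_join_empty[of V] by (intro exI[of _ "{}"]) auto
next
  case (step v w)
  then obtain P where P: "P \<subseteq> K" "T_join V (sym_diff {u} {v}) P" by blast
  have e: "{v, w} \<in> K" using step by auto
  then have "v \<noteq> w" "v \<in> V" "w \<in> V" using assms(2) subsetD[OF assms(2) e] by auto
  then have "T_join V (sym_diff {v} {w}) {{v, w}}" by (intro T_join_edge) auto
  then have "T_join V (sym_diff (sym_diff {u} {v}) (sym_diff {v} {w})) (sym_diff P {{v, w}})"
    using T_join_sym_diff[OF assms(1) P(2)] by blast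
  moreover have "sym_diff (sym_diff {u} {v}) (sym_diff {v} {w}) = sym_diff {u} {w}" by auto
  ultimately show ?case using P(1) e by (intro exI[of _ "sym_diff P {{v, w}}"]) auto
qed

text \<open>Evenness in a component provides a partner for each vertex of \<open>T\<close> there.
  The pair is removed, and a path between the two is added to a join for the rest.\<close>

lemma T_join_within:
  assumes "finite V" "K \<subseteq> complete_edges V" "T \<subseteq> V"
    and "\<And>v. v \<in> T \<Longrightarrow> even (card (T \<inter> (adj K)\<^sup>* `` {v}))"
  shows "\<exists>F\<subseteq>K. T_join V T F"
  using assms(3,4)
proof (induction "card T" arbitrary: T rule: less_induct)
  case less
  have fin: "finite T" using less.prems assms(1) finite_subset by blast
  show ?case
  proof (cases "T = {}")
    case True
    then show ?thesis using T_join_empty[of V] by blast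
  next
    case False
    then obtain v where v: "v \<in> T" by blast
    have "T \<inter> (adj K)\<^sup>* `` {v} \<noteq> {v}"
    proof
      assume "T \<inter> (adj K)\<^sup>* `` {v} = {v}"
      then show False using less.prems(2)[OF v] by simp
    qed
    then obtain u where u: "u \<in> T" "u \<noteq> v" "(v, u) \<in> (adj K)\<^sup>*" using v by auto
    let ?T = "T - {u, v}"
    have "?T \<subset> T" using v by auto
    then have small: "card ?T < card T" by (rule psubset_card_mono[OF fin])
    have ev: "even (card (?T \<inter> (adj K)\<^sup>* `` {w}))" if "w \<in> ?T" for w
    proof -
      let ?C = "T \<inter> (adj K)\<^sup>* `` {w}"
      have iff: "u \<in> ?C \<longleftrightarrow> v \<in> ?C"
        using u v by (auto intro: rtrancl_trans dest: sym_adj_rtrancl)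
      have e: "even (card ?C)" using less.prems(2) that by auto
      have fC: "finite ?C" using fin by auto
      show ?thesis
      proof (cases "u \<in> ?C")
        case True
        then have "{u, v} \<subseteq> ?C" using iff by auto
        then have "card (?C - {u, v}) = card ?C - 2"
          using u(2) by (subst card_Diff_subset) (auto simp: card_insert_if)
        moreover have "?C - {u, v} = ?T \<inter> (adj K)\<^sup>* `` {w}" by auto
        ultimately show ?thesis using e by simp
      next
        case False
        then have "?T \<inter> (adj K)\<^sup>* `` {w} = ?C" using iff by auto
        then show ?thesis using e by simp
      qed
    qed
    obtain F where F: "F \<subseteq> K" "T_join V ?T F"
      using less.hyps[OF small _ ev] less.prems by blast
    obtain P where P: "P \<subseteq> K" "T_join V (sym_diff {v} {u}) P"
      using path_join[OF assms(1,2) u(3)] by blast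
    have "sym_diff ?T (sym_diff {v} {u}) = T" using u v by auto
    then have "T_join V T (sym_diff F P)" using T_join_sym_diff[OF assms(1) F(2) P(2)] by simp
    then show ?thesis using F P by (intro exI[of _ "sym_diff F P"]) auto
  qed
qed

lemma T_join_exists:
  assumes "finite V" "T \<subseteq> V" "even (card T)"
  shows "\<exists>F. T_join V T F"
proof -
  have "T \<inter> (adj (complete_edges V))\<^sup>* `` {v} = T" if "v \<in> T" for v
  proof -
    have "(v, u) \<in> (adj (complete_edges V))\<^sup>*" if "u \<in> T" for u
      using assms(2) that \<open>v \<in> T\<close> by (cases "u = v") (auto intro!: r_into_rtrancl)
    then show ?thesis by auto
  qed
  then show ?thesis using T_join_within[OF assms(1) order_refl assms(2)] assms(3) by auto
qed

subsection \<open>The dominant of the \<open>T\<close>-join polytope\<close>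

lemma sum_as_of_bool:
  fixes c :: "'a \<Rightarrow> 'b::comm_semiring_1"
  assumes "finite E" "F \<subseteq> E"
  shows "sum c F = (\<Sum>e\<in>E. c e * of_bool (e \<in> F))"
proof -
  have "sum c F = (\<Sum>e\<in>F. c e * of_bool (e \<in> F))" by simp
  also have "\<dots> = (\<Sum>e\<in>E. c e * of_bool (e \<in> F))"
    using assms by (intro sum.mono_neutral_left) auto
  finally show ?thesis .
qed

lemma sum_sym_diff:
  fixes c :: "'a \<Rightarrow> nat"
  assumes "finite A" "finite B"
  shows "sum c (sym_diff A B) + 2 * sum c (A \<inter> B) = sum c A + sum c B"
proof -
  have "sum c A = sum c (A - B) + sum c (A \<inter> B)" "sum c B = sum c (B - A) + sum c (A \<inter> B)"
    using assms sum.Int_Diff[of A c B] sum.Int_Diff[of B c A] by (auto simp: Int_commute)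
  moreover have "sum c (sym_diff A B) = sum c (A - B) + sum c (B - A)"
    using assms by (intro sum.union_disjoint) auto
  ultimately show ?thesis by simp
qed

lemma T_join_finite: "finite V \<Longrightarrow> T_join V T F \<Longrightarrow> finite F"
  unfolding T_join_def using finite_subset finite_complete_edges by metis

text \<open>Used to close a cycle through \<open>S\<close>. Outside \<open>S\<close>, the component
  of an outer end \<open>u1\<close> in \<open>D\<close> may miss \<open>a\<close>. Then it contains
  neither terminal, as \<open>b\<close> lies in \<open>S\<close>, so \<open>D\<close> leaves it an
  even number of times, always towards \<open>S\<close>, and a second cut edge starts there. If
  instead the outer ends of two cut edges both reach \<open>a\<close>, they are connected through
  \<open>a\<close>.\<close>

lemma two_connected_cut_edges:
  assumes "finite V" "T_join V (sym_diff {a} {b}) D" "b \<in> S" "S \<subseteq> V"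
    and "card (D \<inter> cut V S) \<ge> 2"
  shows "\<exists>s1 u1 s2 u2. {s1, u1} \<in> D \<and> {s2, u2} \<in> D \<and> {s1, u1} \<noteq> {s2, u2} \<and>
    s1 \<in> S \<and> s2 \<in> S \<and> u1 \<in> V - S \<and> u2 \<in> V - S \<and> (u1, u2) \<in> (adj {e \<in> D. e \<subseteq> V - S})\<^sup>*"
proof -
  let ?D = "{e \<in> D. e \<subseteq> V - S}"
  have finD: "finite D" using assms T_join_finite by blast
  have D: "D \<subseteq> complete_edges V" using assms by (auto simp: T_join_def)
  have main: ?thesis
    if e: "{s1, u1} \<in> D" "s1 \<in> S" "u1 \<in> V - S" and a: "(u1, a) \<notin> (adj ?D)\<^sup>*" for s1 u1
  proof -
    let ?K = "(adj ?D)\<^sup>* `` {u1}"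
    have K: "?K \<subseteq> V - S"
      using e(3) by (intro adj_rtrancl_Image_subset) auto
    have "?K \<inter> sym_diff {a} {b} = {}" using a K assms(3) by auto
    then have "even (card (D \<inter> cut V ?K))"
      using T_join_cut_parity[OF assms(1,2), of ?K] K by auto
    moreover have "{s1, u1} \<in> D \<inter> cut V ?K" using e K assms(4) by auto
    ultimately have "D \<inter> cut V ?K \<noteq> {{s1, u1}}" by auto
    then obtain f where f: "f \<in> D" "f \<in> cut V ?K" "f \<noteq> {s1, u1}"
      using \<open>{s1, u1} \<in> D \<inter> cut V ?K\<close> by auto
    from f(2) obtain u2 s2 where uv: "f = {u2, s2}" "u2 \<in> ?K" "s2 \<notin> ?K" "u2 \<in> V" "s2 \<in> V"
      by (rule cutE)
    have "s2 \<in> S"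
    proof (rule ccontr)
      assume "s2 \<notin> S"
      then have "(u2, s2) \<in> adj ?D" using uv K f by auto
      then show False using uv(2,3) by (auto intro: rtrancl_into_rtrancl)
    qed
    moreover have "u2 \<in> V - S" "(u1, u2) \<in> (adj ?D)\<^sup>*" using uv(2) K by auto
    moreover have "{s2, u2} = f" using uv(1) by auto
    ultimately show ?thesis using e f(1,3) \<open>s2 \<in> S\<close> by blast
  qed
  have not_single: "\<not> D \<inter> cut V S \<subseteq> {e}" for e
  proof
    assume "D \<inter> cut V S \<subseteq> {e}"
    then have "card (D \<inter> cut V S) \<le> card {e}" by (intro card_mono) auto
    then show False using assms(5) by simp
  qed
  then obtain e1 where "e1 \<in> D \<inter> cut V S" by blast
  with not_single[of e1] obtain e2 where e12: "e1 \<in> D" "e1 \<in> cut V S" "e2 \<in> D" "e2 \<in> cut V S" "e1 \<noteq> e2" by blast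
  from e12(2) obtain s1 u1 where 1: "e1 = {s1, u1}" "s1 \<in> S" "u1 \<notin> S" "s1 \<in> V" "u1 \<in> V" by (rule cutE)
  from e12(4) obtain s2 u2 where 2: "e2 = {s2, u2}" "s2 \<in> S" "u2 \<notin> S" "s2 \<in> V" "u2 \<in> V" by (rule cutE)
  show ?thesis
  proof (cases "(u1, a) \<in> (adj ?D)\<^sup>* \<and> (u2, a) \<in> (adj ?D)\<^sup>*")
    case True
    then have "(u1, u2) \<in> (adj ?D)\<^sup>*" by (blast intro: rtrancl_trans dest: sym_adj_rtrancl)
    then show ?thesis using 1 2 e12 by blast
  next
    case False
    then show ?thesis using main[of s1 u1] main[of s2 u2] 1 2 e12 by blast
  qed
qed

text \<open>
  Induction on the total cost. Fix \<open>a \<in> T\<close> in a component of the zero cost edges that contains an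
  odd number of vertices of \<open>T\<close>. Over all vertices \<open>b\<close>, take a cheapest join \<open>N\<close> for \<open>T\<close> with \<open>a\<close>
  moved to \<open>b\<close>, and let \<open>S\<close> be the zero cost component of \<open>b\<close>. Then \<open>N\<close> misses \<open>\<delta>(S)\<close>, and lowering
  the costs on \<open>\<delta>(S)\<close> by 1 lowers the optimum by at most 1: if a \<open>T\<close>-join \<open>F\<close> meets \<open>\<delta>(S)\<close> more
  than once, exchanging a cycle between \<open>F\<close> and \<open>N\<close> makes \<open>N\<close> strictly more expensive and hence \<open>F\<close>
  strictly cheaper, by at least 2 because cycles have even cost.
\<close>

lemma integral_T_join_le:
  fixes c :: "'a set \<Rightarrow> nat" and y :: "'a set \<Rightarrow> real"
  assumes "finite V" "T \<subseteq> V" "even (card T)"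
    and y0: "\<And>e. e \<in> complete_edges V \<Longrightarrow> y e \<ge> 0"
    and ycut: "\<And>S. S \<subseteq> V \<Longrightarrow> odd (card (S \<inter> T)) \<Longrightarrow> sum y (cut V S) \<ge> 1"
    and "\<And>C. T_join V {} C \<Longrightarrow> even (sum c C)"
  shows "\<exists>F. T_join V T F \<and> real (sum c F) \<le> (\<Sum>e\<in>complete_edges V. real (c e) * y e)"
  using assms(6)
proof (induction "sum c (complete_edges V)" arbitrary: c rule: less_induct)
  case less
  let ?E = "complete_edges V"
  have finE: "finite ?E" using assms(1) by simp
  define Z where "Z = {e \<in> ?E. c e = 0}"
  have Z: "Z \<subseteq> ?E" by (auto simp: Z_def)
  define cls where "cls v = (adj Z)\<^sup>* `` {v}" for v
  have cls_self: "v \<in> cls v" for v by (simp add: cls_def)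
  have cls_sub: "cls v \<subseteq> V" if "v \<in> V" for v
    unfolding cls_def using that Z by (intro adj_rtrancl_Image_subset) auto
  have cZ: "sum c P = 0" if "P \<subseteq> Z" for P using that unfolding Z_def by (intro sum.neutral) auto
  show ?case
  proof (cases "\<forall>v\<in>T. even (card (T \<inter> cls v))")
    case True
    then obtain F where "F \<subseteq> Z" "T_join V T F"
      using T_join_within[OF assms(1) Z assms(2)] unfolding cls_def by blast
    then show ?thesis using cZ[of F] y0 by (intro exI[of _ F]) (auto intro!: sum_nonneg)
  next
    case False
    then obtain a where a: "a \<in> T" "odd (card (T \<inter> cls a))" by blast
    obtain F0 where F0: "T_join V T F0" using T_join_exists[OF assms(1-3)] by blast
    \<comment> \<open>The move is meant modulo 2: if \<open>b\<close> is already in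
      \<open>T - {a}\<close>, the two cancel. Minimizing over \<open>b\<close> and \<open>N\<close>
      together is what keeps \<open>N\<close> inside or outside \<open>S\<close>.\<close>
    define Q where "Q = (\<lambda>(b, N). b \<in> V \<and> T_join V (sym_diff (T - {a}) {b}) N)"
    have "sym_diff (T - {a}) {a} = T" using a by auto
    then have "Q (a, F0)" using a assms(2) F0 by (auto simp: Q_def)
    then obtain bN where "Q bN" and min: "\<And>z. Q z \<Longrightarrow> sum c (snd bN) \<le> sum c (snd z)"
      using ex_has_least_nat[of Q "(a, F0)" "\<lambda>z. sum c (snd z)"] by auto
    obtain b N where bN: "bN = (b, N)" by fastforce
    have b: "b \<in> V" and N: "T_join V (sym_diff (T - {a}) {b}) N"
      using \<open>Q bN\<close> by (auto simp: Q_def bN)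
    have min: "sum c N \<le> sum c N'" if "b' \<in> V" "T_join V (sym_diff (T - {a}) {b'}) N'" for b' N'
      using min[of "(b', N')"] that by (auto simp: Q_def bN)
    define S where "S = cls b"
    have SV: "S \<subseteq> V" unfolding S_def by (rule cls_sub[OF b])
    have bS: "b \<in> S" by (simp add: S_def cls_self)
    have cutpos: "c e > 0" if "e \<in> cut V S" for e
    proof (rule ccontr)
      assume "\<not> c e > 0"
      then have "e \<in> Z" using that cut_subset by (auto simp: Z_def)
      from that obtain u v where "e = {u, v}" "u \<in> S" "v \<notin> S" "u \<in> V" "v \<in> V" by (rule cutE)
      then show False using \<open>e \<in> Z\<close> unfolding S_def cls_def
        by (auto intro: rtrancl_into_rtrancl)
    qed
    \<comment> \<open>A cut edge \<open>{u, v}\<close> of \<open>N'\<close> could be dropped: a zero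
      cost path from \<open>b\<close> to \<open>u\<close> moves the terminal to \<open>v\<close>,
      and the positive cost of the edge is saved, against the choice of \<open>N\<close>.
      Consequently any exchange that puts a cut edge into \<open>N\<close> makes it strictly more
      expensive.\<close>
    have misses: "N' \<inter> cut V S = {}"
      if N': "T_join V (sym_diff (T - {a}) {b}) N'" "sum c N' \<le> sum c N" for N'
    proof (rule ccontr)
      assume "N' \<inter> cut V S \<noteq> {}"
      then obtain e where e: "e \<in> N'" "e \<in> cut V S" by blast
      from e(2) obtain u v where uv: "e = {u, v}" "u \<in> S" "v \<notin> S" "u \<in> V" "v \<in> V" by (rule cutE)
      have "(b, u) \<in> (adj Z)\<^sup>*" using uv by (auto simp: S_def cls_def)
      then obtain P where P: "P \<subseteq> Z" "T_join V (sym_diff {b} {u}) P"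
        using path_join[OF assms(1) Z] by blast
      have "T_join V (sym_diff {u} {v}) {e}" using uv by (intro T_join_edge) auto
      from T_join_sym_diff[OF assms(1) T_join_sym_diff[OF assms(1) N'(1) this] P(2)]
      have "T_join V (sym_diff (T - {a}) {v}) (sym_diff (sym_diff N' {e}) P)"
        by (rule back_subst[of "\<lambda>T. T_join V T _"]) auto
      then have "sum c N \<le> sum c (sym_diff (sym_diff N' {e}) P)" using min uv by blast
      also have "\<dots> \<le> sum c (sym_diff N' {e}) + sum c P"
        using sum_sym_diff[of "sym_diff N' {e}" P c] T_join_finite[OF assms(1)] N'(1) P by fastforce
      also have "\<dots> = sum c (N' - {e})" using cZ[OF P(1)] e by (simp add: insert_absorb Un_absorb2)
      also have "\<dots> < sum c N'"
        using e cutpos[OF e(2)] sum.remove[of N' e c] T_join_finite[OF assms(1) N'(1)] by simp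
      finally show False using N'(2) by simp
    qed
    have Nmiss: "N \<inter> cut V S = {}" using misses N by blast
    have finS: "finite S" using SV assms(1) finite_subset by blast
    have "even (card (S \<inter> sym_diff (T - {a}) {b}))"
      using T_join_cut_parity[OF assms(1) N SV] Nmiss by simp
    moreover have "S \<inter> sym_diff (T - {a}) {b} = sym_diff (S \<inter> (T - {a})) {b}" using bS by auto
    ultimately have oddS': "odd (card (S \<inter> (T - {a})))"
      using even_card_sym_diff[of "S \<inter> (T - {a})" "{b}"] finS by simp
    \<comment> \<open>Otherwise \<open>S\<close> is the component of \<open>a\<close>, which is odd
      for \<open>T\<close> and therefore even for \<open>T - {a}\<close>.\<close>
    have "a \<notin> S"
    proof
      assume "a \<in> S"
      then have "cls a = S" unfolding S_def cls_def
        by (auto intro: rtrancl_trans dest: sym_adj_rtrancl)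
      then have "odd (card (S \<inter> T))" using a by (simp add: Int_commute)
      moreover have "S \<inter> (T - {a}) = (S \<inter> T) - {a}" by auto
      ultimately show False using oddS' \<open>a \<in> S\<close> a(1) finS by auto
    qed
    then have "S \<inter> (T - {a}) = S \<inter> T" and ab: "a \<noteq> b" using bS by auto
    then have oddS: "odd (card (S \<inter> T))" using oddS' by simp
    \<comment> \<open>The truncated subtraction loses nothing, since edges of the cut have positive
      cost.\<close>
    define d where "d e = c e - of_bool (e \<in> cut V S)" for e
    have cd: "c e = d e + of_bool (e \<in> cut V S)" for e
      using cutpos[of e] by (auto simp: d_def)
    have sumcd: "sum c F = sum d F + card (F \<inter> cut V S)" if "finite F" for F
      using that by (simp add: cd sum.distrib of_bool_def sum.If_cases Int_def)
    have improve: "\<exists>F'. T_join V T F' \<and> card (F' \<inter> cut V S) < card (F \<inter> cut V S) \<and> sum d F' \<le> sum d F"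
      if F: "T_join V T F" "card (F \<inter> cut V S) \<ge> 2" for F
    proof -
      define D where "D = sym_diff F N"
      have "T_join V (sym_diff T (sym_diff (T - {a}) {b})) D"
        unfolding D_def by (rule T_join_sym_diff[OF assms(1) F(1) N])
      moreover have "sym_diff T (sym_diff (T - {a}) {b}) = sym_diff {a} {b}" using a ab by auto
      ultimately have D: "T_join V (sym_diff {a} {b}) D" by simp
      have Dcut: "D \<inter> cut V S = F \<inter> cut V S" using Nmiss by (auto simp: D_def)
      have "card (D \<inter> cut V S) \<ge> 2" using F(2) Dcut by simp
      from two_connected_cut_edges[OF assms(1) D bS SV this] obtain s1 u1 s2 u2 where
        su: "{s1, u1} \<in> D" "{s2, u2} \<in> D" "{s1, u1} \<noteq> {s2, u2}" "s1 \<in> S" "s2 \<in> S"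
          "u1 \<in> V - S" "u2 \<in> V - S" "(u1, u2) \<in> (adj {e \<in> D. e \<subseteq> V - S})\<^sup>*"
        by blast
      have "{e \<in> D. e \<subseteq> V - S} \<subseteq> ?E" using D by (auto simp: T_join_def)
      from path_join[OF assms(1) this su(8)] obtain P where
        P: "P \<subseteq> {e \<in> D. e \<subseteq> V - S}" "T_join V (sym_diff {u1} {u2}) P" by blast
      let ?ZS = "{e \<in> Z. e \<subseteq> S}"
      have s12: "(s1, s2) \<in> (adj ?ZS)\<^sup>*"
      proof -
        have "(b, v) \<in> (adj ?ZS)\<^sup>*" if "(b, v) \<in> (adj Z)\<^sup>*" for v
          using that
        proof induction
          case (step v w)
          then have "v \<in> S" "w \<in> S" unfolding S_def cls_def by (auto intro: rtrancl_into_rtrancl)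
          then have "(v, w) \<in> adj ?ZS" using step by auto
          then show ?case using step by (meson rtrancl_into_rtrancl)
        qed auto
        then have "(b, s1) \<in> (adj ?ZS)\<^sup>*" "(b, s2) \<in> (adj ?ZS)\<^sup>*"
          using su unfolding S_def cls_def by auto
        then show ?thesis by (blast intro: rtrancl_trans dest: sym_adj_rtrancl)
      qed
      have "?ZS \<subseteq> ?E" using Z by auto
      from path_join[OF assms(1) this s12] obtain R where
        R: "R \<subseteq> ?ZS" "T_join V (sym_diff {s1} {s2}) R" by blast
      obtain e1 e2 where e: "e1 = {s1, u1}" "e2 = {s2, u2}" by blast
      have eD: "e1 \<in> D" "e2 \<in> D" "e1 \<noteq> e2" using su(1-3) e by simp_all
      \<comment> \<open>\<open>P\<close> runs in \<open>D\<close> outside \<open>S\<close> and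
        \<open>R\<close> returns inside \<open>S\<close> at zero cost, so \<open>C\<close> crosses
        the cut in \<open>e1\<close> and \<open>e2\<close> only.\<close>
      define C where "C = sym_diff (sym_diff {e1} {e2}) (sym_diff P R)"
      have "T_join V (sym_diff {s1} {u1}) {e1}" "T_join V (sym_diff {s2} {u2}) {e2}"
        using T_join_edge[OF e(1), of V] T_join_edge[OF e(2), of V] su(4-7) SV by blast+
      from T_join_sym_diff[OF assms(1) T_join_sym_diff[OF assms(1) this] T_join_sym_diff[OF assms(1) P(2) R(2)]]
      have C: "T_join V {} C" unfolding C_def
        by (rule back_subst[of "\<lambda>T. T_join V T _"]) blast
      have e12: "e1 \<in> cut V S" "e2 \<in> cut V S" using e su(4-7) SV by auto
      have "P \<inter> cut V S = {}" "R \<inter> cut V S = {}"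
        using P(1) R(1) by (blast elim: cutE)+
      then have Ccut: "C \<inter> cut V S = {e1, e2}" using e12 eD(3) unfolding C_def by blast
      have CDZ: "C \<subseteq> D \<union> Z" using eD P R unfolding C_def by blast
      have finC: "finite C" using T_join_finite[OF assms(1) C] .
      have finF: "finite F" using T_join_finite[OF assms(1) F(1)] .
      define F' where "F' = sym_diff F C"
      have F': "T_join V T F'" using T_join_sym_diff[OF assms(1) F(1) C] by (simp add: F'_def)
      define N' where "N' = sym_diff N C"
      have N': "T_join V (sym_diff (T - {a}) {b}) N'"
        using T_join_sym_diff[OF assms(1) N C] by (simp add: N'_def)
      have "e1 \<in> N' \<inter> cut V S" using Ccut Nmiss unfolding N'_def by blast
      then have "sum c N < sum c N'" using misses[OF N'] by fastforce
      \<comment> \<open>Apart from zero cost edges, every edge of \<open>C\<close> lies in exactly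
        one of \<open>F\<close> and \<open>N\<close>; switching along \<open>C\<close> passes it
        from one to the other.\<close>
      moreover have "sum c N' + sum c F' = sum c N + sum c F"
      proof -
        have "F \<subseteq> ?E" "F' \<subseteq> ?E" "N \<subseteq> ?E" "N' \<subseteq> ?E"
          using F F' N N' by (auto simp: T_join_def)
        moreover have "c e * of_bool (e \<in> N') + c e * of_bool (e \<in> F')
            = c e * of_bool (e \<in> N) + c e * of_bool (e \<in> F)" for e
          using CDZ unfolding N'_def F'_def D_def Z_def by (cases "e \<in> C") auto
        ultimately show ?thesis
          by (simp add: sum_as_of_bool[OF finE, of _ c] sum.distrib[symmetric])
      qed
      ultimately have "sum c F' < sum c F" by simp
      moreover have "even (sum c C)" using less.prems C by blast
      moreover have "sum c F' + 2 * sum c (F \<inter> C) = sum c F + sum c C"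
        unfolding F'_def by (rule sum_sym_diff[OF finF finC])
      moreover have "a + 2 \<le> b" if "a < b" "even k" "a + 2 * x = b + k" for a b x k :: nat
        using that by presburger
      ultimately have "sum c F' + 2 \<le> sum c F" by blast
      have sub: "{e1, e2} \<subseteq> F \<inter> cut V S" using e12 eD Dcut by blast
      have "F' \<inter> cut V S = (F \<inter> cut V S) - {e1, e2}"
        using Ccut sub unfolding F'_def by blast
      then have k: "card (F' \<inter> cut V S) = card (F \<inter> cut V S) - 2"
        using sub eD(3) by (simp add: card_Diff_subset)
      have "finite F'" using T_join_finite[OF assms(1) F'] .
      \<comment> \<open>Losing two cut edges forfeits a discount of 2 in \<open>d\<close>, which the
        drop of at least 2 in \<open>c\<close> covers.\<close>
      then have "sum d F' \<le> sum d F"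
        using \<open>sum c F' + 2 \<le> sum c F\<close> sumcd[OF finF] sumcd[of F'] k F(2) by simp
      then show ?thesis using F' k F(2) by (intro exI[of _ F']) auto
    qed
    have single: "\<exists>F'. T_join V T F' \<and> card (F' \<inter> cut V S) = 1 \<and> sum d F' \<le> sum d F"
      if "T_join V T F" for F
      using that
    proof (induction "card (F \<inter> cut V S)" arbitrary: F rule: less_induct)
      case (less F)
      \<comment> \<open>Oddness excludes 0, so decreasing the number of crossings ends at exactly
        1.\<close>
      have "odd (card (F \<inter> cut V S))"
        using T_join_cut_parity[OF assms(1) less.prems SV] oddS by simp
      then consider "card (F \<inter> cut V S) = 1" | "card (F \<inter> cut V S) \<ge> 2"
        by (cases "card (F \<inter> cut V S) \<ge> 2") (auto simp: not_le less_2_cases_iff)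
      then show ?case
      proof cases
        case 2
        from improve[OF less.prems this] show ?thesis using less.hyps order_trans by blast
      qed (use less.prems in auto)
    qed
    have "cut V S \<noteq> {}"
      using T_join_cut_parity[OF assms(1) F0 SV] oddS by auto
    moreover have "cut V S \<subseteq> ?E" by (rule cut_subset)
    ultimately have "sum d ?E < sum c ?E"
      using sumcd[OF finE] finE by (simp add: Int_absorb1 card_gt_0_iff finite_subset)
    \<comment> \<open>The parity hypothesis survives because a join for the empty set meets every
      cut in an even number of edges.\<close>
    moreover have "even (sum d C)" if C: "T_join V {} C" for C
      using less.prems[OF C] sumcd[OF T_join_finite[OF assms(1) C]]
        T_join_cut_parity[OF assms(1) C SV] by simp
    ultimately obtain F1 where F1: "T_join V T F1" "real (sum d F1) \<le> (\<Sum>e\<in>?E. real (d e) * y e)"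
      using less.hyps[of d] by blast
    obtain F where F: "T_join V T F" "card (F \<inter> cut V S) = 1" "sum d F \<le> sum d F1"
      using single[OF F1(1)] by blast
    have "(\<Sum>e\<in>?E. real (c e) * y e) = (\<Sum>e\<in>?E. real (d e) * y e) + (\<Sum>e\<in>?E. y e * of_bool (e \<in> cut V S))"
      by (simp add: cd algebra_simps sum.distrib)
    also have "(\<Sum>e\<in>?E. y e * of_bool (e \<in> cut V S)) = sum y (cut V S)"
      by (rule sum_as_of_bool[symmetric, OF finE cut_subset])
    finally have "(\<Sum>e\<in>?E. real (c e) * y e) \<ge> (\<Sum>e\<in>?E. real (d e) * y e) + 1"
      using ycut[OF SV oddS] by simp
    moreover have "sum c F = sum d F + 1" using sumcd[OF T_join_finite[OF assms(1) F(1)]] F(2) by simp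
    moreover have "real (sum d F) \<le> real (sum d F1)" using F(3) by (rule of_nat_mono)
    ultimately have "real (sum c F) \<le> (\<Sum>e\<in>?E. real (c e) * y e)" using F1(2) by linarith
    then show ?thesis using F(1) by blast
  qed
qed

lemma min_T_join_le:
  fixes c y :: "'a set \<Rightarrow> real"
  assumes "finite V" "T \<subseteq> V" "even (card T)"
    and c0: "\<And>e. e \<in> complete_edges V \<Longrightarrow> c e \<ge> 0"
    and y0: "\<And>e. e \<in> complete_edges V \<Longrightarrow> y e \<ge> 0"
    and ycut: "\<And>S. S \<subseteq> V \<Longrightarrow> odd (card (S \<inter> T)) \<Longrightarrow> sum y (cut V S) \<ge> 1"
    and F: "min_cost_T_join V c T F"
  shows "sum c F \<le> (\<Sum>e\<in>complete_edges V. c e * y e)"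
proof -
  let ?E = "complete_edges V"
  have approx: "sum c F \<le> (\<Sum>e\<in>?E. c e * y e) + sum y ?E / real k" if k: "k > 0" for k :: nat
  proof -
    \<comment> \<open>Costs are rounded up at scale \<open>k\<close>, and the factor 2 makes every
      edge set have even cost. The error of at most 2 per edge becomes
      \<open>sum y ?E / real k\<close> after division by \<open>2 * k\<close>, and vanishes as
      \<open>k\<close> grows.\<close>
    define d where "d e = 2 * nat \<lceil>real k * c e\<rceil>" for e
    have d1: "2 * real k * c e \<le> real (d e)" if "e \<in> ?E" for e
      using real_nat_ceiling_ge[of "real k * c e"] by (simp add: d_def)
    have d2: "real (d e) \<le> 2 * real k * c e + 2" if "e \<in> ?E" for e
      using c0[OF that] of_int_ceiling_le_add_one[of "real k * c e"] by (simp add: d_def) linarith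
    have "\<exists>F. T_join V T F \<and> real (sum d F) \<le> (\<Sum>e\<in>?E. real (d e) * y e)"
      using assms by (intro integral_T_join_le) (auto simp: d_def dvd_sum)
    then obtain G where G: "T_join V T G" "real (sum d G) \<le> (\<Sum>e\<in>?E. real (d e) * y e)" by blast
    have "2 * real k * sum c F \<le> 2 * real k * sum c G"
      using F G k by (auto simp: min_cost_T_join_def)
    also have "\<dots> \<le> real (sum d G)"
      unfolding sum_distrib_left of_nat_sum using G(1) by (intro sum_mono d1) (auto simp: T_join_def)
    also have "\<dots> \<le> (\<Sum>e\<in>?E. real (d e) * y e)" by (rule G(2))
    also have "\<dots> \<le> (\<Sum>e\<in>?E. (2 * real k * c e + 2) * y e)"
      by (intro sum_mono mult_right_mono d2 y0)
    also have "\<dots> = 2 * real k * ((\<Sum>e\<in>?E. c e * y e) + sum y ?E / real k)"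
      using k by (simp add: field_simps sum.distrib sum_distrib_left)
    finally show ?thesis using k by simp
  qed
  show ?thesis
  proof (rule field_le_epsilon)
    fix r :: real assume "r > 0"
    obtain k :: nat where k: "sum y ?E / r < real k" using reals_Archimedean2 by blast
    have "sum y ?E \<ge> 0" by (intro sum_nonneg y0)
    then have "k > 0" using k \<open>r > 0\<close> by (cases k) (auto simp: divide_less_0_iff not_less field_simps)
    have "sum y ?E / real k \<le> r"
      using k \<open>r > 0\<close> \<open>k > 0\<close> by (simp add: field_simps)
    then show "sum c F \<le> (\<Sum>e\<in>?E. c e * y e) + r" using approx[OF \<open>k > 0\<close>] by simp
  qed
qed

subsection \<open>Eulerian trails and shortcuts\<close>

lemma walk_edges_simps [simp]:
  "walk_edges [] = []" "walk_edges [u] = []"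
  "walk_edges (u # v # W) = {u, v} # walk_edges (v # W)"
  by (simp_all add: walk_edges_def)

lemma walk_edges_append:
  "walk_edges (xs @ u # ys) = walk_edges (xs @ [u]) @ walk_edges (u # ys)"
proof (induction xs)
  case (Cons x xs)
  then show ?case by (cases xs) auto
qed simp

lemma walk_edge_subset: "e \<in> set (walk_edges W) \<Longrightarrow> e \<subseteq> set W"
  by (induction W rule: induct_list012) auto

lemma in_walk_edge: "v \<in> set W \<Longrightarrow> length W \<ge> 2 \<Longrightarrow> \<exists>e\<in>set (walk_edges W). v \<in> e"
proof (induction W rule: induct_list012)
  case (3 x y zs)
  then show ?case by (cases zs) auto
qed auto

lemma length_walk_edges: "length (walk_edges W) = length W - 1"
  by (simp add: walk_edges_def)

text \<open>An edge may lie in both the tree and the join, so degrees in their union count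
  multiplicities.\<close>

definition mdegree :: "'a set multiset \<Rightarrow> 'a \<Rightarrow> nat" where
  "mdegree M v = size (filter_mset (\<lambda>e. v \<in> e) M)"

lemma mdegree_simps [simp]:
  "mdegree {#} v = 0"
  "mdegree (add_mset e M) v = of_bool (v \<in> e) + mdegree M v"
  "mdegree (M + N) v = mdegree M v + mdegree N v"
  by (simp_all add: mdegree_def)

lemma mdegree_mset_set: "finite K \<Longrightarrow> mdegree (mset_set K) v = degree K v"
  by (simp add: mdegree_def degree_def)

lemma walk_parity:
  assumes "W \<noteq> []" "\<forall>e\<in>set (walk_edges W). card e = 2"
  shows "odd (mdegree (mset (walk_edges W)) v) \<longleftrightarrow> v \<in> sym_diff {hd W} {last W}"
  using assms
proof (induction W rule: induct_list012)
  case (3 x y zs)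
  then have "x \<noteq> y" by auto
  with 3 show ?case by auto
qed auto

text \<open>Removing a first edge \<open>{u, v}\<close> moves the odd vertex from \<open>u\<close>
  to \<open>v\<close>. The walk stops only at a vertex without remaining edges; its degree 0 is
  even, so it is \<open>t\<close>. The case \<open>u = t\<close> yields closed trails, which are
  nontrivial as soon as some edge meets \<open>u\<close>.\<close>

lemma greedy_trail:
  assumes "\<forall>e\<in>#M. card e = 2" "\<And>v. odd (mdegree M v) \<longleftrightarrow> v \<in> sym_diff {u} {t}"
  shows "\<exists>W. W \<noteq> [] \<and> hd W = u \<and> last W = t \<and> mset (walk_edges W) \<subseteq># M \<and>
    ((\<exists>e\<in>#M. u \<in> e) \<longrightarrow> length W \<ge> 2)"
  using assms
proof (induction "size M" arbitrary: M u rule: less_induct)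
  case less
  show ?case
  proof (cases "\<exists>e\<in>#M. u \<in> e")
    case True
    then obtain e where e: "e \<in># M" "u \<in> e" by blast
    obtain v where v: "e = {u, v}" "u \<noteq> v"
      using e less.prems(1) by (metis card_2_iff doubleton_eq_iff insert_iff singletonD)
    obtain M' where M': "M = add_mset e M'" using e by (auto dest: multi_member_split)
    have "odd (mdegree M' w) \<longleftrightarrow> w \<in> sym_diff {v} {t}" for w
      using less.prems(2)[of w] v unfolding M' by auto
    with less.hyps[of M' v] less.prems(1) obtain W where
      W: "W \<noteq> []" "hd W = v" "last W = t" "mset (walk_edges W) \<subseteq># M'"
      by (auto simp: M')
    then have "walk_edges (u # W) = e # walk_edges W" using v by (cases W) auto
    then show ?thesis using W by (intro exI[of _ "u # W"]) (cases W; auto simp: M')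
  next
    case False
    then have "filter_mset (\<lambda>e. u \<in> e) M = {#}" by auto
    then have "mdegree M u = 0" by (simp add: mdegree_def)
    then have "u = t" using less.prems(2)[of u] by auto
    then show ?thesis using False by (intro exI[of _ "[u]"]) auto
  qed
qed

lemma eulerian_trail_exists:
  assumes card2: "\<forall>e\<in>#M. card e = 2"
    and parity: "\<And>v. odd (mdegree M v) \<longleftrightarrow> v \<in> sym_diff {s} {t}"
    and conn: "\<And>e. e \<in># M \<Longrightarrow> \<exists>v\<in>e. (s, v) \<in> (adj (set_mset M))\<^sup>*"
  shows "\<exists>W. eulerian_trail s t M W"
proof -
  define Q where "Q W \<longleftrightarrow> W \<noteq> [] \<and> hd W = s \<and> last W = t \<and> mset (walk_edges W) \<subseteq># M" for W
  obtain W0 where "Q W0" using greedy_trail[OF card2 parity] unfolding Q_def by blast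
  have bound: "length W \<le> Suc (size M)" if "Q W" for W
  proof -
    have "length (walk_edges W) \<le> size M"
      using that size_mset_mono[of "mset (walk_edges W)" M] by (simp add: Q_def)
    then show ?thesis by (simp add: length_walk_edges)
  qed
  obtain W where W: "Q W" and max: "\<And>W'. Q W' \<Longrightarrow> length W' \<le> length W"
    using ex_has_greatest_nat[of Q W0 length "Suc (Suc (size M))"] \<open>Q W0\<close> bound
    by (auto simp: less_Suc_eq_le)
  define R where "R = M - mset (walk_edges W)"
  have M: "M = mset (walk_edges W) + R" using W by (simp add: R_def Q_def)
  have "R = {#}"
  proof (rule ccontr)
    assume "R \<noteq> {#}"
    then obtain e where e: "e \<in># R" by blast
    have "\<exists>f\<in>#R. \<exists>u\<in>f. u \<in> set W"
    proof (rule ccontr)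
      assume none: "\<not> (\<exists>f\<in>#R. \<exists>u\<in>f. u \<in> set W)"
      have "(adj (set_mset M))\<^sup>* `` {s} \<subseteq> set W"
      proof (rule adj_rtrancl_Image_subset)
        fix a b assume ab: "{a, b} \<in> set_mset M" "a \<in> set W"
        then have "{a, b} \<in> set (walk_edges W)" using none unfolding M by auto
        then show "b \<in> set W" using walk_edge_subset by fastforce
      qed (use W in \<open>auto simp: Q_def\<close>)
      moreover have "e \<in># M" using e unfolding M by simp
      ultimately show False using conn[of e] none e by blast
    qed
    then obtain f u where u: "f \<in># R" "u \<in> f" "u \<in> set W" by blast
    have walk2: "\<forall>e\<in>set (walk_edges W). card e = 2" using card2 unfolding M by auto
    have "odd (mdegree R v) \<longleftrightarrow> v \<in> sym_diff {u} {u}" for v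
      using walk_parity[OF _ walk2, of v] parity[of v] W unfolding M Q_def by auto
    moreover have "\<forall>e\<in>#R. card e = 2" using card2 unfolding M by auto
    ultimately obtain C where C: "C \<noteq> []" "hd C = u" "last C = u" "mset (walk_edges C) \<subseteq># R"
      "length C \<ge> 2" using greedy_trail[of R u u] u by blast
    obtain W1 W2 where W12: "W = W1 @ u # W2" using u(3) by (auto dest: split_list)
    obtain C1 where C1: "C = u # C1" using C by (cases C) auto
    obtain C2 where C2: "C = C2 @ [u]" using C by (metis append_butlast_last_id)
    have "walk_edges (W1 @ C @ W2) = walk_edges (W1 @ [u]) @ walk_edges (C @ W2)"
      unfolding C1 using walk_edges_append[of W1 u "C1 @ W2"] by simp
    also have "walk_edges (C @ W2) = walk_edges C @ walk_edges (u # W2)"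
      unfolding C2 using walk_edges_append[of C2 u W2] by simp
    finally have "mset (walk_edges (W1 @ C @ W2)) = mset (walk_edges W) + mset (walk_edges C)"
      unfolding W12 using walk_edges_append[of W1 u W2] by simp
    then have "mset (walk_edges (W1 @ C @ W2)) \<subseteq># M" using C(4) unfolding M by simp
    moreover have "hd (W1 @ C @ W2) = s" using W C1 by (cases W1) (auto simp: Q_def W12)
    moreover have "last (W1 @ C @ W2) = t" using W C2 by (cases W2) (auto simp: Q_def W12)
    ultimately have "Q (W1 @ C @ W2)" using C by (simp add: Q_def)
    from max[OF this] show False using C(5) by (simp add: W12)
  qed
  then show ?thesis using W M by (auto simp: eulerian_trail_def Q_def)
qed

section \<open>Shortcuts under metric costs\<close>

lemma shortcut_step_length: "shortcut_step W P \<Longrightarrow> length P < length W"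
  by (auto elim!: shortcut_step.cases)

lemma shortcut_step_props:
  assumes "shortcut_step W P"
  shows "P \<noteq> []" "hd P = hd W" "last P = last W" "set P = set W"
  using assms by (auto elim!: shortcut_step.cases)

lemma shortcut_exists: "\<exists>P. shortcut W P"
proof (induction "length W" arbitrary: W rule: less_induct)
  case less
  show ?case
  proof (cases "\<exists>W'. shortcut_step W W'")
    case True
    then obtain W' where W': "shortcut_step W W'" by blast
    then obtain P where "shortcut W' P" using less shortcut_step_length by blast
    then show ?thesis using W' unfolding shortcut_def
      by (meson converse_rtranclp_into_rtranclp)
  next
    case False
    then show ?thesis unfolding shortcut_def by blast
  qed
qed

text \<open>Of two occurrences of a vertex at least one is interior, because the two ends of the
  walk differ; a step can skip it.\<close>

lemma distinct_if_no_shortcut_step: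
  assumes "\<nexists>P'. shortcut_step P P'" "hd P \<noteq> last P"
  shows "distinct P"
proof (rule ccontr)
  assume "\<not> distinct P"
  then obtain xs y ys zs where P: "P = xs @ [y] @ ys @ [y] @ zs"
    using not_distinct_decomp by blast
  show False
  proof (cases "xs = []")
    case False
    then have "shortcut_step (xs @ y # (ys @ y # zs)) (xs @ (ys @ y # zs))"
      by (intro shortcut_step.intros) auto
    then show False using assms P by auto
  next
    case True
    then have "zs \<noteq> []" using assms(2) P by auto
    then have "shortcut_step ((y # ys) @ y # zs) ((y # ys) @ zs)"
      by (intro shortcut_step.intros) auto
    then show False using assms True P by auto
  qed
qed

text \<open>Shortcutting may create steps \<open>{u}\<close> from a vertex to itself, for which \<open>c\<close> is unconstrained.\<close>

definition loopless_cost :: "('a set \<Rightarrow> real) \<Rightarrow> 'a set \<Rightarrow> real" where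
  "loopless_cost c e = (if card e = 2 then c e else 0)"

lemma loopless_cost_triangle:
  assumes "metric_costs V c" "u \<in> V" "v \<in> V" "w \<in> V"
  shows "loopless_cost c {u, w} \<le> loopless_cost c {u, v} + loopless_cost c {v, w}"
proof -
  have nonneg: "loopless_cost c {a, b} \<ge> 0" if "a \<in> V" "b \<in> V" for a b
    using assms(1) that by (cases "a = b") (auto simp: metric_costs_def loopless_cost_def)
  consider "u = v" | "v = w" | "u = w" | "u \<noteq> v" "v \<noteq> w" "u \<noteq> w" by blast
  then show ?thesis
  proof cases
    case 4
    then show ?thesis using assms by (auto simp: metric_costs_def loopless_cost_def)
  next
    case 3
    then show ?thesis using nonneg[OF assms(2,3)] by (simp add: loopless_cost_def insert_commute)
  qed (auto simp: loopless_cost_def)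
qed

lemma shortcut_step_cost:
  assumes "shortcut_step W P" "metric_costs V c" "set W \<subseteq> V"
  shows "path_cost (loopless_cost c) P \<le> path_cost (loopless_cost c) W"
  using assms(1)
proof cases
  case (1 xs ys v)
  obtain xs' u where xs: "xs = xs' @ [u]" using \<open>xs \<noteq> []\<close> by (metis append_butlast_last_id)
  obtain w ys' where ys: "ys = w # ys'" using \<open>ys \<noteq> []\<close> by (cases ys) auto
  have "walk_edges W = walk_edges (xs' @ [u]) @ {u, v} # {v, w} # walk_edges (w # ys')"
    "walk_edges P = walk_edges (xs' @ [u]) @ {u, w} # walk_edges (w # ys')"
    using walk_edges_append[of xs' u "v # w # ys'"] walk_edges_append[of xs' u "w # ys'"]
    unfolding 1 xs ys by simp_all
  then show ?thesis using loopless_cost_triangle[OF assms(2), of u v w] assms(3)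
    unfolding path_cost_def 1 xs ys by auto
qed

lemma shortcut_props:
  assumes "shortcut W P" "W \<noteq> []" "metric_costs V c" "set W \<subseteq> V"
  shows "P \<noteq> []" "hd P = hd W" "last P = last W" "set P = set W"
    "path_cost (loopless_cost c) P \<le> path_cost (loopless_cost c) W"
proof -
  have "shortcut_step\<^sup>*\<^sup>* W P" using assms by (simp add: shortcut_def)
  then have "P \<noteq> [] \<and> hd P = hd W \<and> last P = last W \<and> set P = set W \<and>
    path_cost (loopless_cost c) P \<le> path_cost (loopless_cost c) W"
  proof induction
    case (step Y Z)
    then show ?case
      using shortcut_step_props[OF step(2)] shortcut_step_cost[OF step(2) assms(3)] assms(4) by auto
  qed (use assms in auto)
  then show "P \<noteq> []" "hd P = hd W" "last P = last W" "set P = set W"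
    "path_cost (loopless_cost c) P \<le> path_cost (loopless_cost c) W" by auto
qed

lemma path_cost_loopless:
  "\<forall>e\<in>set (walk_edges P). card e = 2 \<Longrightarrow> path_cost (loopless_cost c) P = path_cost c P"
  unfolding path_cost_def by (intro arg_cong[of _ _ sum_list]) (auto simp: loopless_cost_def)

lemma distinct_walk_edges_card: "distinct P \<Longrightarrow> \<forall>e\<in>set (walk_edges P). card e = 2"
  by (induction P rule: induct_list012) auto

section \<open>The path obtained from one sampled tree\<close>

lemma wrong_degree_eq:
  assumes "s \<in> V" "t \<in> V"
  shows "wrong_degree V s t K = sym_diff {v \<in> V. odd (degree K v)} {s, t}"
  using assms by (auto simp: wrong_degree_def)

lemma even_card_wrong_degree:
  assumes "finite V" "s \<in> V" "t \<in> V" "s \<noteq> t" "K \<subseteq> complete_edges V"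
  shows "even (card (wrong_degree V s t K))"
proof -
  have "T_join V {v \<in> V. odd (degree K v)} K" using assms by (simp add: T_join_def)
  \<comment> \<open>For \<open>S = V\<close> the cut is empty, which makes this the handshake
    lemma.\<close>
  from T_join_cut_parity[OF assms(1) this order_refl]
  have "even (card {v \<in> V. odd (degree K v)})"
    by (simp add: cut_def complete_edges_def Int_absorb1 Int_absorb2 Collect_conv_if cong: conj_cong)
  then show ?thesis unfolding wrong_degree_eq[OF assms(2,3)]
    using assms by (subst even_card_sym_diff) auto
qed

lemma connects_incident:
  assumes "connects V K" "u \<in> V" "v \<in> V" "u \<noteq> v"
  shows "\<exists>e\<in>K. v \<in> e"
proof -
  have "(v, u) \<in> (adj K)\<^sup>*" using assms by (auto simp: connects_def)
  then show ?thesis using assms(4) by (cases rule: converse_rtranclE) auto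
qed

text \<open>As \<open>s\<close> and \<open>t\<close> differ, connectivity puts every vertex on a
  tree edge and hence on \<open>W\<close>. The loopless cost equals \<open>c\<close> before and
  after shortcutting: \<open>W\<close> consists of genuine edges, and \<open>P\<close> repeats no
  vertex.\<close>

lemma christofides_path_hamiltonian:
  assumes "finite V" "s \<in> V" "t \<in> V" "s \<noteq> t" "metric_costs V c"
    and "K \<subseteq> complete_edges V" "connects V K" "christofides_path V c s t K P"
  shows "hamiltonian_path V s t P"
    "\<exists>F. min_cost_T_join V c (wrong_degree V s t K) F \<and> path_cost c P \<le> sum c K + sum c F"
proof -
  obtain F W where F: "min_cost_T_join V c (wrong_degree V s t K) F"
    and W: "eulerian_trail s t (mset_set K + mset_set F) W" and P: "shortcut W P"
    using assms(8) by (auto simp: christofides_path_def)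
  have FE: "F \<subseteq> complete_edges V" using F by (auto simp: min_cost_T_join_def T_join_def)
  have fin: "finite K" "finite F" using assms(1,6) FE finite_subset finite_complete_edges by metis+
  have "W \<noteq> []" "hd W = s" "last W = t" and mW: "mset (walk_edges W) = mset_set K + mset_set F"
    using W by (auto simp: eulerian_trail_def)
  have sW: "set (walk_edges W) = K \<union> F"
    using arg_cong[OF mW, of set_mset] fin by simp
  have "length W \<ge> 2"
    using \<open>W \<noteq> []\<close> \<open>hd W = s\<close> \<open>last W = t\<close> assms(4) by (cases W rule: remdups_adj.cases) auto
  have WV: "set W \<subseteq> V"
  proof
    fix v assume "v \<in> set W"
    from in_walk_edge[OF this \<open>length W \<ge> 2\<close>] show "v \<in> V"
      using sW FE assms(6) by (auto simp: complete_edges_def)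
  qed
  have VW: "V \<subseteq> set W"
  proof
    fix v assume "v \<in> V"
    obtain u where "u \<in> V" "u \<noteq> v" using assms(2-4) by metis
    then obtain e where "e \<in> K" "v \<in> e" using connects_incident[OF assms(7)] \<open>v \<in> V\<close> by blast
    then show "v \<in> set W" using sW walk_edge_subset by fastforce
  qed
  note props = shortcut_props[OF P \<open>W \<noteq> []\<close> assms(5) WV]
  have "distinct P"
    using P assms(4) props \<open>hd W = s\<close> \<open>last W = t\<close>
    by (intro distinct_if_no_shortcut_step) (auto simp: shortcut_def)
  then show "hamiltonian_path V s t P"
    using props \<open>hd W = s\<close> \<open>last W = t\<close> WV VW by (auto simp: hamiltonian_path_def)
  have "path_cost c P = path_cost (loopless_cost c) P"
    using path_cost_loopless[OF distinct_walk_edges_card[OF \<open>distinct P\<close>]] by simp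
  also have "\<dots> \<le> path_cost (loopless_cost c) W" by (rule props)
  also have "\<dots> = path_cost c W"
    by (rule path_cost_loopless) (use sW FE assms(6) in \<open>auto simp: complete_edges_def\<close>)
  also have "\<dots> = sum_mset (image_mset c (mset (walk_edges W)))"
    by (simp add: path_cost_def flip: sum_mset_sum_list)
  also have "\<dots> = sum c K + sum c F"
    unfolding mW by (simp add: sum_unfold_sum_mset)
  finally show "\<exists>F. min_cost_T_join V c (wrong_degree V s t K) F \<and> path_cost c P \<le> sum c K + sum c F"
    using F by blast
qed

text \<open>Adding the join changes the parity exactly at the wrong degree vertices and leaves only
  \<open>s\<close> and \<open>t\<close> odd; the tree alone provides connectivity.\<close>

lemma christofides_path_exists:
  assumes "finite V" "s \<in> V" "t \<in> V" "s \<noteq> t" "K \<subseteq> complete_edges V" "connects V K"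
  shows "\<exists>P. christofides_path V c s t K P"
proof -
  define T where "T = wrong_degree V s t K"
  have "T \<subseteq> V" using assms by (auto simp: T_def wrong_degree_def)
  then obtain F0 where "T_join V T F0"
    using T_join_exists[OF assms(1)] even_card_wrong_degree[OF assms(1-5)] by (auto simp: T_def)
  moreover have "finite {F. T_join V T F}"
    by (rule finite_subset[of _ "Pow (complete_edges V)"]) (use assms in \<open>auto simp: T_join_def\<close>)
  ultimately obtain F where F: "T_join V T F" "\<And>F'. T_join V T F' \<Longrightarrow> sum c F \<le> sum c F'"
    using arg_min_if_finite[of "{F. T_join V T F}" "sum c"]
    by (metis empty_iff mem_Collect_eq not_less)
  have FE: "F \<subseteq> complete_edges V" using F by (auto simp: T_join_def)
  have fin: "finite K" "finite F" using assms FE finite_subset finite_complete_edges by metis+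
  let ?M = "mset_set K + mset_set F"
  have "\<exists>W. eulerian_trail s t ?M W"
  proof (rule eulerian_trail_exists)
    show "\<forall>e\<in>#?M. card e = 2" using assms(5) FE fin by (auto simp: complete_edges_def)
  next
    fix v
    have out: "degree K v = 0 \<and> degree F v = 0" if "v \<notin> V"
    proof -
      have "{e \<in> K. v \<in> e} = {}" "{e \<in> F. v \<in> e} = {}"
        using that assms(5) FE by (auto simp: complete_edges_def)
      then show ?thesis by (simp only: degree_def card.empty)
    qed
    have "v \<in> V \<Longrightarrow> odd (degree F v) \<longleftrightarrow> v \<in> T" using F(1) by (auto simp: T_join_def)
    then show "odd (mdegree ?M v) \<longleftrightarrow> v \<in> sym_diff {s} {t}"
      using out fin assms(2-4) by (cases "v \<in> V") (auto simp: mdegree_mset_set T_def wrong_degree_def)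
  next
    fix e assume "e \<in># ?M"
    then have "e \<in> complete_edges V" using assms(5) FE fin by auto
    then obtain u where u: "u \<in> e" "u \<in> V" by (auto elim: complete_edgesE)
    have "(s, u) \<in> (adj K)\<^sup>*" using assms u by (auto simp: connects_def)
    moreover have "adj K \<subseteq> adj (set_mset ?M)" using fin by auto
    ultimately have "(s, u) \<in> (adj (set_mset ?M))\<^sup>*" using rtrancl_mono by blast
    then show "\<exists>v\<in>e. (s, v) \<in> (adj (set_mset ?M))\<^sup>*" using u by blast
  qed
  then obtain W where "eulerian_trail s t ?M W" by blast
  moreover obtain P where "shortcut W P" using shortcut_exists by blast
  ultimately show ?thesis using F unfolding christofides_path_def min_cost_T_join_def T_def by blast
qed

subsection \<open>The spanning tree polytope\<close>

definition edge_components :: "'a set \<Rightarrow> 'a set set \<Rightarrow> 'a set set" where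
  "edge_components V K = (\<lambda>v. (adj K)\<^sup>* `` {v}) ` V"

lemma finite_edge_components [simp]: "finite V \<Longrightarrow> finite (edge_components V K)"
  by (simp add: edge_components_def)

lemma class_eq_iff: "(adj K)\<^sup>* `` {u} = (adj K)\<^sup>* `` {v} \<longleftrightarrow> (u, v) \<in> (adj K)\<^sup>*"
  by (auto intro: rtrancl_trans dest: sym_adj_rtrancl)

lemma card_components_pos: "finite V \<Longrightarrow> V \<noteq> {} \<Longrightarrow> card (edge_components V K) > 0"
  by (simp add: edge_components_def card_gt_0_iff)

lemma edge_components_empty: "edge_components V {} = (\<lambda>v. {v}) ` V"
  by (simp add: edge_components_def)

lemma card_components_empty: "card (edge_components V {}) = card V"
  by (simp add: edge_components_empty card_image)

lemma card_components_connected: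
  assumes "connects V K" "V \<noteq> {}"
  shows "card (edge_components V K) = 1"
proof -
  obtain v where "v \<in> V" using assms by blast
  have "(adj K)\<^sup>* `` {u} = (adj K)\<^sup>* `` {v}" if "u \<in> V" for u
    unfolding class_eq_iff using assms(1) \<open>v \<in> V\<close> that by (simp add: connects_def)
  then have "edge_components V K = {(adj K)\<^sup>* `` {v}}"
    unfolding edge_components_def using \<open>v \<in> V\<close> by blast
  then show ?thesis by simp
qed

lemma adj_mono: "K \<subseteq> L \<Longrightarrow> adj K \<subseteq> adj L"
  by auto

lemma edge_components_coarser:
  assumes "K \<subseteq> L"
  shows "edge_components V L = (\<lambda>C. (adj L)\<^sup>* `` C) ` edge_components V K"
proof -
  have "(adj L)\<^sup>* `` ((adj K)\<^sup>* `` {v}) = (adj L)\<^sup>* `` {v}" for v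
    using rtrancl_mono[OF adj_mono[OF assms]] by (auto intro: rtrancl_trans)
  then show ?thesis unfolding edge_components_def image_image by simp
qed

lemma card_components_insert_less:
  assumes "finite V" "a \<in> V" "b \<in> V" "(a, b) \<notin> (adj K)\<^sup>*"
  shows "card (edge_components V (insert {a, b} K)) < card (edge_components V K)"
proof -
  let ?L = "insert {a, b} K"
  let ?f = "\<lambda>C. (adj ?L)\<^sup>* `` C"
  have eq: "edge_components V ?L = ?f ` edge_components V K" by (rule edge_components_coarser) auto
  have "\<not> inj_on ?f (edge_components V K)"
  proof
    assume inj: "inj_on ?f (edge_components V K)"
    have in_comp: "(adj K)\<^sup>* `` {a} \<in> edge_components V K" "(adj K)\<^sup>* `` {b} \<in> edge_components V K"
      using assms by (auto simp: edge_components_def)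
    have sub: "(adj K)\<^sup>* \<subseteq> (adj ?L)\<^sup>*" by (intro rtrancl_mono adj_mono) auto
    have "?f ((adj K)\<^sup>* `` {v}) = (adj ?L)\<^sup>* `` {v}" for v
      using sub by (auto intro: rtrancl_trans)
    moreover have "(adj ?L)\<^sup>* `` {a} = (adj ?L)\<^sup>* `` {b}"
      unfolding class_eq_iff by (rule r_into_rtrancl) auto
    ultimately have "(adj K)\<^sup>* `` {a} = (adj K)\<^sup>* `` {b}"
      by (intro inj_onD[OF inj _ in_comp]) (simp only:)
    then show False using assms(4) unfolding class_eq_iff by blast
  qed
  moreover have "card (?f ` edge_components V K) \<le> card (edge_components V K)"
    using assms by (intro card_image_le) auto
  ultimately show ?thesis using eq_card_imp_inj_on[of "edge_components V K" ?f] assms(1) eq by fastforce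
qed

text \<open>A new connection uses \<open>{a, b}\<close>, so one of its ends was already connected to
  \<open>b\<close>. Components other than that of \<open>b\<close> are therefore not merged with
  each other, and one more edge removes at most one component.\<close>

lemma rtrancl_adj_insert:
  assumes "(u, v) \<in> (adj (insert {a, b} K))\<^sup>*" "(u, v) \<notin> (adj K)\<^sup>*"
  shows "(u, b) \<in> (adj K)\<^sup>* \<or> (v, b) \<in> (adj K)\<^sup>*"
proof (rule ccontr)
  assume no: "\<not> ?thesis"
  have "(u, v) \<in> (adj K)\<^sup>* \<or> (u, a) \<in> (adj K)\<^sup>* \<and> (b, v) \<in> (adj K)\<^sup>*"
    using assms(1)
  proof induction
    case (step y z)
    consider "{y, z} \<in> K" | "y = a" "z = b" | "y = b" "z = a"
      using step(2) by (auto simp: doubleton_eq_iff)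
    then show ?case
    proof cases
      case 1
      then have "(y, z) \<in> adj K" by simp
      then show ?thesis using step.IH by (meson rtrancl_into_rtrancl)
    qed (use step.IH no in \<open>auto\<close>)
  qed auto
  then show False using no assms(2) sym_adj_rtrancl[of b v K] by simp
qed

lemma card_components_insert_ge:
  assumes "finite V" "b \<in> V"
  shows "card (edge_components V K) \<le> Suc (card (edge_components V (insert {a, b} K)))"
proof -
  let ?L = "insert {a, b} K"
  let ?f = "\<lambda>C. (adj ?L)\<^sup>* `` C" and ?B = "(adj K)\<^sup>* `` {b}"
  have sub: "(adj K)\<^sup>* \<subseteq> (adj ?L)\<^sup>*" by (intro rtrancl_mono adj_mono) auto
  have f: "?f ((adj K)\<^sup>* `` {v}) = (adj ?L)\<^sup>* `` {v}" for v
    using sub by (auto intro: rtrancl_trans)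
  have "inj_on ?f (edge_components V K - {?B})"
  proof (rule inj_onI)
    fix C D assume C: "C \<in> edge_components V K - {?B}" and D: "D \<in> edge_components V K - {?B}" and eq: "?f C = ?f D"
    obtain u v where uv: "C = (adj K)\<^sup>* `` {u}" "D = (adj K)\<^sup>* `` {v}"
      using C D by (auto simp: edge_components_def)
    have "(u, v) \<in> (adj ?L)\<^sup>*" using eq unfolding uv f class_eq_iff .
    moreover have "(u, b) \<notin> (adj K)\<^sup>*" "(v, b) \<notin> (adj K)\<^sup>*"
      using C D unfolding uv class_eq_iff[symmetric] by blast+
    ultimately have "(u, v) \<in> (adj K)\<^sup>*" using rtrancl_adj_insert[of u v a b K] by metis
    then show "C = D" unfolding uv class_eq_iff .
  qed
  then have "card (edge_components V K - {?B}) = card (?f ` (edge_components V K - {?B}))"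
    by (simp add: card_image)
  also have "\<dots> \<le> card (edge_components V ?L)"
    using assms edge_components_coarser[of K ?L V] by (intro card_mono) auto
  finally have "card (edge_components V K - {?B}) \<le> card (edge_components V ?L)" .
  moreover have "?B \<in> edge_components V K" using assms(2) by (simp add: edge_components_def)
  ultimately show ?thesis using assms(1) card_Suc_Diff1[of "edge_components V K" ?B] by simp
qed

lemma card_le_components_plus_edges:
  assumes "finite V" "K \<subseteq> complete_edges V"
  shows "card V \<le> card (edge_components V K) + card K"
proof -
  have "finite K" using assms finite_subset finite_complete_edges by metis
  then show ?thesis using assms(2)
  proof (induction K)
    case (insert e K)
    then obtain a b where "e = {a, b}" "b \<in> V" by (auto elim: complete_edgesE)
    then show ?case using insert card_components_insert_ge[OF assms(1), of b K a] by auto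
  qed (simp add: card_components_empty)
qed

text \<open>While \<open>Z\<close> does not connect \<open>V\<close>, some edge of \<open>A\<close>
  joins two of its components. Each such edge lowers their number, so fewer edges than components
  suffice.\<close>

lemma few_connecting_edges:
  assumes "finite V" "V \<noteq> {}" "A \<subseteq> complete_edges V" "connects V (Z \<union> A)"
  shows "\<exists>B\<subseteq>A. connects V (Z \<union> B) \<and> Suc (card B) \<le> card (edge_components V Z)"
  using assms(4)
proof (induction "card (edge_components V Z)" arbitrary: Z rule: less_induct)
  case less
  show ?case
  proof (cases "connects V Z")
    case True
    then show ?thesis using card_components_pos[OF assms(1,2), of Z]
      by (intro exI[of _ "{}"]) auto
  next
    case False
    have "\<exists>a b. {a, b} \<in> A \<and> (a, b) \<notin> (adj Z)\<^sup>*"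
    proof (rule ccontr)
      assume "\<not> ?thesis"
      then have "adj (Z \<union> A) \<subseteq> (adj Z)\<^sup>*" by auto
      then have "(adj (Z \<union> A))\<^sup>* \<subseteq> (adj Z)\<^sup>*" by (rule rtrancl_subset_rtrancl)
      then show False using less.prems False unfolding connects_def by blast
    qed
    then obtain a b where ab: "{a, b} \<in> A" "(a, b) \<notin> (adj Z)\<^sup>*" by blast
    then have "a \<in> V" "b \<in> V" using subsetD[OF assms(3) ab(1)] by auto
    then have less': "card (edge_components V (insert {a, b} Z)) < card (edge_components V Z)"
      using card_components_insert_less[OF assms(1)] ab(2) by blast
    have "insert {a, b} Z \<union> A = Z \<union> A" using ab by auto
    then obtain B where B: "B \<subseteq> A" "connects V (insert {a, b} Z \<union> B)"
      "Suc (card B) \<le> card (edge_components V (insert {a, b} Z))"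
      using less.hyps[OF less'] less.prems by auto
    have "card (insert {a, b} B) \<le> Suc (card B)" by (rule card_insert_le_m1) auto
    then show ?thesis using ab B less' by (intro exI[of _ "insert {a, b} B"]) auto
  qed
qed

definition crossing :: "'a set \<Rightarrow> 'a set set \<Rightarrow> 'a set set" where
  "crossing V Z = {e \<in> complete_edges V. \<not> (\<exists>C\<in>edge_components V Z. e \<subseteq> C)}"

lemma doubleton_in_crossing:
  assumes "u \<in> V" "v \<in> V" "u \<noteq> v"
  shows "{u, v} \<in> crossing V Z \<longleftrightarrow> (u, v) \<notin> (adj Z)\<^sup>*"
proof -
  have "(\<exists>C\<in>edge_components V Z. {u, v} \<subseteq> C) \<longleftrightarrow> (u, v) \<in> (adj Z)\<^sup>*"
  proof
    assume "\<exists>C\<in>edge_components V Z. {u, v} \<subseteq> C"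
    then show "(u, v) \<in> (adj Z)\<^sup>*"
      by (auto simp: edge_components_def intro: rtrancl_trans dest: sym_adj_rtrancl)
  next
    assume "(u, v) \<in> (adj Z)\<^sup>*"
    then show "\<exists>C\<in>edge_components V Z. {u, v} \<subseteq> C"
      using assms unfolding edge_components_def by (intro bexI[of _ "(adj Z)\<^sup>* `` {u}"]) auto
  qed
  moreover have "{u, v} \<in> complete_edges V" using assms by simp
  ultimately show ?thesis unfolding crossing_def by blast
qed

text \<open>
  Lower the weights of all edges between different components of the zero weight edges by the same
  amount, until another edge gets weight zero. A connecting set needs only one such edge less than
  there are components, whereas \<open>x\<close> has at least this much value on these edges.
\<close>

lemma light_connecting_set:
  fixes w x :: "'a set \<Rightarrow> real"
  assumes "finite V" "V \<noteq> {}"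
    and x0: "\<And>e. e \<in> complete_edges V \<Longrightarrow> x e \<ge> 0"
    and partition: "\<And>Z. Z \<subseteq> complete_edges V \<Longrightarrow> real (card (edge_components V Z)) \<le> sum x (crossing V Z) + 1"
    and "\<And>e. e \<in> complete_edges V \<Longrightarrow> w e \<ge> 0"
  shows "\<exists>J\<subseteq>complete_edges V. connects V J \<and> Suc (card J) \<le> card V \<and>
    sum w J \<le> (\<Sum>e\<in>complete_edges V. w e * x e)"
  using assms(5)
proof (induction "card {e \<in> complete_edges V. w e \<noteq> 0}" arbitrary: w rule: less_induct)
  case less
  let ?E = "complete_edges V"
  have finE: "finite ?E" using assms(1) by simp
  define Z where "Z = {e \<in> ?E. w e = 0}"
  have ZE: "Z \<subseteq> ?E" by (auto simp: Z_def)
  \<comment> \<open>Starting from no edges, the components are single vertices, so every connecting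
    set can be thinned to at most \<open>card V - 1\<close> edges.\<close>
  have small: "\<exists>J\<subseteq>A. connects V J \<and> Suc (card J) \<le> card V" if "A \<subseteq> ?E" "connects V A" for A
    using few_connecting_edges[OF assms(1,2) that(1), of "{}"] that(2) by (simp add: card_components_empty)
  define X where "X = crossing V Z"
  have XE: "X \<subseteq> ?E" by (auto simp: X_def crossing_def)
  have finX: "finite X" using XE finE finite_subset by blast
  show ?case
  proof (cases "X = {}")
    case True
    have "connects V Z"
      unfolding connects_def
    proof (intro ballI)
      fix u v assume "u \<in> V" "v \<in> V"
      then show "(u, v) \<in> (adj Z)\<^sup>*"
        using doubleton_in_crossing[of u V v Z] True by (cases "u = v") (auto simp: X_def)
    qed
    then obtain J where J: "J \<subseteq> Z" "connects V J" "Suc (card J) \<le> card V"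
      using small[OF ZE] by blast
    have "sum w J = 0" using J(1) unfolding Z_def by (intro sum.neutral) auto
    then show ?thesis using J ZE x0 less.prems by (intro exI[of _ J]) (auto intro!: sum_nonneg)
  next
    case False
    define r where "r = Min (w ` X)"
    have rX: "r \<le> w e" if "e \<in> X" for e using finX that by (simp add: r_def)
    have "r \<in> w ` X" unfolding r_def using finX False by (intro Min_in) auto
    then obtain e0 where e0: "e0 \<in> X" "w e0 = r" by blast
    have Xpos: "w e > 0" if "e \<in> X" for e
    proof -
      have eE: "e \<in> ?E" using that XE by blast
      then obtain u v where uv: "e = {u, v}" "u \<noteq> v" "u \<in> V" "v \<in> V" by (rule complete_edgesE)
      then have "(u, v) \<notin> (adj Z)\<^sup>*" using that doubleton_in_crossing[of u V v Z] by (simp add: X_def)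
      then have "e \<notin> Z" using uv by auto
      then show ?thesis using less.prems[OF eE] eE by (auto simp: Z_def)
    qed
    have "r > 0" using Xpos e0 by force
    define w' where "w' e = w e - r * of_bool (e \<in> X)" for e
    have "{e \<in> ?E. w' e \<noteq> 0} \<subset> {e \<in> ?E. w e \<noteq> 0}"
    proof
      show "{e \<in> ?E. w' e \<noteq> 0} \<subseteq> {e \<in> ?E. w e \<noteq> 0}"
        using Xpos by (fastforce simp: w'_def)
      have "e0 \<in> {e \<in> ?E. w e \<noteq> 0}" "e0 \<notin> {e \<in> ?E. w' e \<noteq> 0}"
        using e0 XE \<open>r > 0\<close> by (auto simp: w'_def)
      then show "{e \<in> ?E. w' e \<noteq> 0} \<noteq> {e \<in> ?E. w e \<noteq> 0}" by blast
    qed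
    then have "card {e \<in> ?E. w' e \<noteq> 0} < card {e \<in> ?E. w e \<noteq> 0}"
      using finE by (intro psubset_card_mono) auto
    moreover have w'0: "w' e \<ge> 0" if "e \<in> ?E" for e
      using rX less.prems[OF that] by (auto simp: w'_def)
    ultimately obtain J where J: "J \<subseteq> ?E" "connects V J" "sum w' J \<le> (\<Sum>e\<in>?E. w' e * x e)"
      using less.hyps[of w'] by blast
    have finJ: "finite J" using J finE finite_subset by blast
    \<comment> \<open>\<open>J\<close> is light for \<open>w'\<close> but may contain too many edges
      of \<open>X\<close> to be light for \<open>w\<close>. Only a part \<open>B\<close> with fewer
      edges than components is kept; zero weight edges do the remaining connecting.\<close>
    have "connects V (Z \<union> J)" using J(2) rtrancl_mono[OF adj_mono[of J "Z \<union> J"]]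
      unfolding connects_def by blast
    then obtain B where B: "B \<subseteq> J" "connects V (Z \<union> B)" "Suc (card B) \<le> card (edge_components V Z)"
      using few_connecting_edges[OF assms(1,2) J(1)] by blast
    have finB: "finite B" using B finJ finite_subset by blast
    obtain K where K: "K \<subseteq> Z \<union> B" "connects V K" "Suc (card K) \<le> card V"
      using small[of "Z \<union> B"] B J ZE by blast
    have KE: "K \<subseteq> ?E" using K B J ZE by blast
    have "sum w K = sum w (K - Z)"
      using KE finE finite_subset unfolding Z_def by (intro sum.mono_neutral_right) auto
    also have "\<dots> \<le> sum w B"
      using K B J finB less.prems by (intro sum_mono2) auto
    also have "\<dots> = sum w' B + r * card (B \<inter> X)"
      using finB by (simp add: w'_def sum_subtractf sum_distrib_left[symmetric] of_bool_def sum.If_cases Int_def)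
    also have "\<dots> \<le> sum w' J + r * sum x X"
    proof (intro add_mono mult_left_mono)
      show "sum w' B \<le> sum w' J" using B J finJ w'0 by (intro sum_mono2) auto
      have "card (B \<inter> X) \<le> card B" using finB by (intro card_mono) auto
      then show "real (card (B \<inter> X)) \<le> sum x X"
        using B(3) partition[OF ZE] unfolding X_def by linarith
    qed (use \<open>r > 0\<close> in auto)
    also have "r * sum x X = (\<Sum>e\<in>?E. r * of_bool (e \<in> X) * x e)"
      unfolding sum_distrib_left using XE finE
      by (intro sum.mono_neutral_cong_left) auto
    also have "sum w' J + \<dots> \<le> (\<Sum>e\<in>?E. w' e * x e) + (\<Sum>e\<in>?E. r * of_bool (e \<in> X) * x e)"
      using J(3) by simp
    also have "\<dots> = (\<Sum>e\<in>?E. w e * x e)"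
      by (simp add: w'_def sum.distrib[symmetric] algebra_simps)
    finally show ?thesis using K KE by blast
  qed
qed

section \<open>Connecting sets with few edges are trees\<close>

lemma walk_reaches:
  "W \<noteq> [] \<Longrightarrow> set (walk_edges W) \<subseteq> K \<Longrightarrow> (hd W, last W) \<in> (adj K)\<^sup>*"
proof (induction W rule: induct_list012)
  case (3 x y zs)
  then have "(x, y) \<in> adj K" by auto
  then show ?case using 3 by (auto intro: converse_rtrancl_into_rtrancl)
qed auto

text \<open>An edge of a cycle could be removed without disconnecting \<open>V\<close>, but
  connecting \<open>V\<close> takes at least \<open>card V - 1\<close> edges.\<close>

lemma spanning_tree_if_few_edges:
  assumes "finite V" "V \<noteq> {}" "J \<subseteq> complete_edges V" "connects V J" "Suc (card J) \<le> card V"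
  shows "spanning_tree V J"
proof -
  have finJ: "finite J" using assms finite_subset finite_complete_edges by metis
  have False if cyc: "is_cycle J C" for C
  proof -
    obtain a m D where C: "C = a # m # D" "D \<noteq> []"
      using cyc unfolding is_cycle_def by (cases C rule: remdups_adj.cases) (auto simp: Suc_le_eq)
    define e where "e = {last C, a}"
    have "walk_edges (C @ [hd C]) = walk_edges C @ [e]"
    proof -
      have "C @ [hd C] = butlast C @ last C # [a]" "butlast C @ [last C] = C" using C by auto
      then show ?thesis using walk_edges_append[of "butlast C" "last C" "[a]"]
        by (simp only: e_def walk_edges_simps)
    qed
    then have sub: "set (walk_edges C) \<subseteq> J" "e \<in> J" using cyc by (auto simp: is_cycle_def)
    have dist: "distinct C" using cyc by (simp add: is_cycle_def)
    \<comment> \<open>The closing edge must differ from the first edge \<open>{a, m}\<close>; this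
      is where a cycle needs length at least 3, that is \<open>D \<noteq> []\<close>.\<close>
    have "e \<notin> set (walk_edges C)"
    proof
      assume "e \<in> set (walk_edges C)"
      moreover have "e \<notin> set (walk_edges (m # D))"
        using walk_edge_subset[of e "m # D"] dist C by (auto simp: e_def)
      ultimately have "e = {a, m}" using C by simp
      then have "last D = m \<or> last D = a" using C by (auto simp: e_def doubleton_eq_iff)
      then show False using dist C last_in_set[of D] by auto
    qed
    then have "set (walk_edges C) \<subseteq> J - {e}" using sub by blast
    from walk_reaches[OF _ this] have reach: "(a, last C) \<in> (adj (J - {e}))\<^sup>*" using C by simp
    have "adj J \<subseteq> (adj (J - {e}))\<^sup>*"
    proof clarify
      fix u v assume uv: "{u, v} \<in> J"
      show "(u, v) \<in> (adj (J - {e}))\<^sup>*"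
      proof (cases "{u, v} = e")
        case True
        then have "u = a \<and> v = last C \<or> u = last C \<and> v = a" by (auto simp: e_def doubleton_eq_iff)
        then show ?thesis using reach sym_adj_rtrancl[OF reach] by blast
      next
        case False
        then have "(u, v) \<in> adj (J - {e})" using uv by simp
        then show ?thesis by (rule r_into_rtrancl)
      qed
    qed
    then have "(adj J)\<^sup>* \<subseteq> (adj (J - {e}))\<^sup>*" by (rule rtrancl_subset_rtrancl)
    then have "connects V (J - {e})" using assms(4) unfolding connects_def by blast
    then have "card V \<le> 1 + card (J - {e})"
      using card_le_components_plus_edges[OF assms(1), of "J - {e}"] assms(3)
        card_components_connected[OF _ assms(2)] by fastforce
    moreover have "card (J - {e}) < card J" using sub(2) finJ by (intro card_Diff1_less)
    ultimately show False using assms(5) by simp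
  qed
  then show ?thesis using assms by (auto simp: spanning_tree_def)
qed

text \<open>If \<open>x\<close> is not in the convex hull, the vector from the closest point of the hull to \<open>x\<close>
  contradicts the assumption.\<close>

lemma convex_combination_if_not_separated:
  fixes x :: "'e \<Rightarrow> real" and p :: "'b \<Rightarrow> 'e \<Rightarrow> real"
  assumes "finite E" "finite B"
    and sep: "\<And>w. \<exists>b\<in>B. (\<Sum>e\<in>E. w e * p b e) \<le> (\<Sum>e\<in>E. w e * x e)"
  shows "\<exists>lam. (\<forall>b\<in>B. lam b \<ge> 0) \<and> sum lam B = 1 \<and> (\<forall>e\<in>E. x e = (\<Sum>b\<in>B. lam b * p b e))"
proof -
  \<comment> \<open>The simplex of coefficients, as functions vanishing outside \<open>B\<close>.
    Every coordinate is confined to a compact set, so Tychonoff's theorem applies.\<close>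
  define L :: "('b \<Rightarrow> real) set" where
    "L = PiE UNIV (\<lambda>b. if b \<in> B then {0..1} else {0}) \<inter> {lam. sum lam B = 1}"
  have "compactin (product_topology (\<lambda>_. euclidean) UNIV) (PiE UNIV (\<lambda>b. if b \<in> B then {0..1::real} else {0}))"
    unfolding compactin_PiE by auto
  then have "compact (PiE UNIV (\<lambda>b. if b \<in> B then {0..1::real} else {0}))"
    unfolding euclidean_product_topology by simp
  moreover have "closed {lam :: 'b \<Rightarrow> real. sum lam B = 1}"
    by (intro closed_Collect_eq continuous_intros) auto
  ultimately have "compact L" unfolding L_def by (rule compact_Int_closed)
  have L_iff: "lam \<in> L \<longleftrightarrow> (\<forall>b\<in>B. 0 \<le> lam b) \<and> (\<forall>b. b \<notin> B \<longrightarrow> lam b = 0) \<and> sum lam B = 1" for lam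
  proof -
    have "lam b \<le> 1" if "b \<in> B" "\<forall>b\<in>B. 0 \<le> lam b" "sum lam B = 1" for b
      using member_le_sum[of b B lam] that assms(2) by auto
    then show ?thesis unfolding L_def by (auto simp: PiE_iff split: if_splits)
  qed
  define z where "z lam e = (\<Sum>b\<in>B. lam b * p b e)" for lam e
  define g where "g lam = (\<Sum>e\<in>E. (x e - z lam e)\<^sup>2)" for lam
  obtain b0 where "b0 \<in> B" using sep by blast
  then have "(\<lambda>b. of_bool (b = b0)) \<in> L" using assms(2) by (simp add: L_iff of_bool_def)
  then have "L \<noteq> {}" by blast
  moreover have "continuous_on L g"
    unfolding g_def z_def
    by (intro continuous_intros continuous_on_subset[OF continuous_on_product_coordinates]) auto
  ultimately obtain lam where lam: "lam \<in> L" and min: "\<And>lam'. lam' \<in> L \<Longrightarrow> g lam \<le> g lam'"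
    using continuous_attains_inf[OF \<open>compact L\<close>] by blast
  define w where "w e = x e - z lam e" for e
  have "g lam = 0"
  proof (rule ccontr)
    assume "g lam \<noteq> 0"
    then have gpos: "g lam > 0" unfolding g_def by (simp add: sum_nonneg less_le)
    \<comment> \<open>With the sign flipped, the hypothesis gives a point \<open>p b\<close> at
      least as far in the direction \<open>w\<close> as \<open>x\<close>, so moving towards it comes
      closer to \<open>x\<close>.\<close>
    obtain b where b: "b \<in> B" "(\<Sum>e\<in>E. - w e * p b e) \<le> (\<Sum>e\<in>E. - w e * x e)"
      using sep[of "\<lambda>e. - w e"] by blast
    define d where "d e = p b e - z lam e" for e
    have "(\<Sum>e\<in>E. w e * d e) - g lam = (\<Sum>e\<in>E. w e * p b e) - (\<Sum>e\<in>E. w e * x e)"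
      unfolding g_def d_def sum_subtractf[symmetric] w_def
      by (intro sum.cong) (auto simp: power2_eq_square algebra_simps)
    then have wd: "(\<Sum>e\<in>E. w e * d e) \<ge> g lam" using b(2) by (simp add: sum_negf)
    define D where "D = (\<Sum>e\<in>E. (d e)\<^sup>2)"
    have "D \<ge> 0" unfolding D_def by (intro sum_nonneg) auto
    \<comment> \<open>The bound 1 keeps \<open>mu\<close> in the simplex. The other term gives
      \<open>h * D \<le> g lam\<close>, so the quadratic loss \<open>h\<^sup>2 * D\<close> is at
      most half of the linear gain \<open>2 * h * g lam\<close>; \<open>D + 1\<close> avoids a zero
      denominator.\<close>
    define h where "h = min 1 (g lam / (D + 1))"
    have h: "0 < h" "h \<le> 1" using gpos \<open>D \<ge> 0\<close> by (auto simp: h_def)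
    have "h * D \<le> g lam / (D + 1) * D" unfolding h_def
      by (rule mult_right_mono) (use \<open>D \<ge> 0\<close> in auto)
    also have "\<dots> \<le> g lam" using gpos \<open>D \<ge> 0\<close> by (simp add: field_simps)
    finally have hD: "h * D \<le> g lam" .
    define mu where "mu b' = (1 - h) * lam b' + h * of_bool (b' = b)" for b'
    have "mu \<in> L" using lam b h(1,2) assms(2)
      unfolding L_iff mu_def by (auto simp: sum.distrib sum_distrib_left[symmetric] of_bool_def)
    have zmu: "x e - z mu e = w e - h * d e" for e
    proof -
      have "z mu e = (1 - h) * z lam e + h * (\<Sum>b'\<in>B. of_bool (b' = b) * p b' e)"
        unfolding z_def mu_def by (simp add: algebra_simps sum.distrib sum_distrib_left sum_subtractf)
      also have "(\<Sum>b'\<in>B. of_bool (b' = b) * p b' e) = p b e"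
        using b(1) assms(2) by (simp add: of_bool_def if_distrib[of "\<lambda>a. a * _"] sum.delta cong: if_cong)
      finally show ?thesis by (simp add: w_def d_def algebra_simps)
    qed
    have "g mu = (\<Sum>e\<in>E. (w e)\<^sup>2) - 2 * h * (\<Sum>e\<in>E. w e * d e) + h\<^sup>2 * D"
      unfolding g_def zmu D_def sum_distrib_left sum_subtractf[symmetric] sum.distrib[symmetric]
      by (intro sum.cong) (auto simp: power2_eq_square algebra_simps)
    also have "(\<Sum>e\<in>E. (w e)\<^sup>2) = g lam" by (simp add: g_def w_def)
    also have "g lam - 2 * h * (\<Sum>e\<in>E. w e * d e) + h\<^sup>2 * D \<le> g lam - 2 * h * g lam + h * g lam"
    proof -
      have "2 * h * g lam \<le> 2 * h * (\<Sum>e\<in>E. w e * d e)" using wd h by simp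
      moreover have "h\<^sup>2 * D \<le> h * g lam"
        using mult_left_mono[OF hD, of h] h by (simp add: power2_eq_square mult.assoc)
      ultimately show ?thesis by linarith
    qed
    also have "\<dots> < g lam" using h(1) gpos by (simp add: algebra_simps)
    finally show False using min[OF \<open>mu \<in> L\<close>] by simp
  qed
  then have "x e = z lam e" if "e \<in> E" for e
    using assms(1) that by (simp add: g_def sum_nonneg_eq_0_iff)
  then show ?thesis using lam unfolding L_iff z_def by blast
qed

subsection \<open>Half-integral solutions of the linear program\<close>

lemma sum_degrees_eq:
  fixes x :: "'a set \<Rightarrow> real"
  assumes "finite V" "S \<subseteq> V"
  shows "(\<Sum>v\<in>S. sum x (cut V {v})) = 2 * sum x {e \<in> complete_edges V. e \<subseteq> S} + sum x (cut V S)"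
proof -
  let ?E = "complete_edges V"
  have finE: "finite ?E" using assms by simp
  have "(\<Sum>v\<in>S. sum x (cut V {v})) = (\<Sum>v\<in>S. \<Sum>e\<in>{e\<in>?E. v \<in> e}. x e)"
    using assms(2) by (intro sum.cong) (auto simp: cut_singleton)
  also have "\<dots> = (\<Sum>e\<in>?E. real (card (e \<inter> S)) * x e)"
    by (rule sum_incident_edges[OF assms order_refl])
  also have "\<dots> = (\<Sum>e\<in>?E. 2 * (x e * of_bool (e \<in> {e \<in> ?E. e \<subseteq> S})) + x e * of_bool (e \<in> cut V S))"
  proof (rule sum.cong[OF refl])
    fix e assume e: "e \<in> ?E"
    have "\<not> (e \<subseteq> S \<and> e \<in> cut V S)" by (auto elim!: cutE)
    then show "real (card (e \<inter> S)) * x e =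
        2 * (x e * of_bool (e \<in> {e \<in> ?E. e \<subseteq> S})) + x e * of_bool (e \<in> cut V S)"
      using e by (auto simp: card_edge_Int[OF e])
  qed
  also have "\<dots> = 2 * sum x {e \<in> ?E. e \<subseteq> S} + sum x (cut V S)"
    unfolding sum_as_of_bool[OF finE cut_subset, of x] sum.distrib sum_distrib_left[symmetric]
    using sum_as_of_bool[OF finE, of "{e \<in> ?E. e \<subseteq> S}" x] by simp
  finally show ?thesis .
qed

text \<open>The degree equations let x(E(S)) and x(\<delta>(S)) determine each other: lower bounds
  on cuts become upper bounds inside \<open>S\<close>, and half-integrality inside \<open>S\<close>
  becomes integrality on \<open>s\<close>-\<open>t\<close> cuts.\<close>

lemma lp_sum_degrees:
  assumes "finite V" "S \<subseteq> V" "lp_feasible V s t x"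
  shows "2 * sum x {e \<in> complete_edges V. e \<subseteq> S} + sum x (cut V S)
    = 2 * real (card S) - real (card (S \<inter> {s, t}))"
proof -
  have finS: "finite S" using assms finite_subset by blast
  have "sum x (cut V {s}) = 1" "sum x (cut V {t}) = 1" "\<forall>v\<in>V - {s, t}. sum x (cut V {v}) = 2"
    using assms(3) unfolding lp_feasible_def by blast+
  then have "(\<Sum>v\<in>S. sum x (cut V {v})) = (\<Sum>v\<in>S. 2 - of_bool (v \<in> {s, t}))"
    using assms(2) by (intro sum.cong) auto
  also have "\<dots> = 2 * real (card S) - real (card (S \<inter> {s, t}))"
    using finS by (simp add: sum_subtractf of_bool_def sum.If_cases Int_def)
  finally show ?thesis using sum_degrees_eq[OF assms(1,2), of x] by simp
qed

lemma cut_full: "cut V V = {}"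
  by (auto elim!: cutE)

lemma lp_sum_all:
  assumes "finite V" "s \<in> V" "t \<in> V" "s \<noteq> t" "lp_feasible V s t x"
  shows "sum x (complete_edges V) = real (card V) - 1"
proof -
  have "{e \<in> complete_edges V. e \<subseteq> V} = complete_edges V" by (auto simp: complete_edges_def)
  moreover have "V \<inter> {s, t} = {s, t}" using assms by auto
  ultimately show ?thesis
    using lp_sum_degrees[OF assms(1) order_refl assms(5)] assms(4) by (simp add: cut_full)
qed

lemma card_Int_doubleton: "card (S \<inter> {s, t}) = 0 \<or> card (S \<inter> {s, t}) = 1 \<or> card (S \<inter> {s, t}) = 2"
  by (auto simp: Int_insert_right card_insert_if)

text \<open>The subtour inequalities of the spanning tree polytope. If \<open>S\<close> contains one
  of \<open>s\<close>, \<open>t\<close>, the degree sum is smaller by 1, which makes up for the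
  weaker cut bound 1.\<close>

lemma lp_sum_inside:
  assumes "finite V" "s \<in> V" "t \<in> V" "s \<noteq> t" "lp_feasible V s t x" "S \<subseteq> V" "S \<noteq> {}"
  shows "sum x {e \<in> complete_edges V. e \<subseteq> S} \<le> real (card S) - 1"
proof (cases "S = V")
  case True
  then have "{e \<in> complete_edges V. e \<subseteq> S} = complete_edges V" by (auto simp: complete_edges_def)
  then show ?thesis using lp_sum_all[OF assms(1-5)] True by simp
next
  case False
  then have proper: "S \<subset> V" using assms by blast
  note deg = lp_sum_degrees[OF assms(1,6,5)]
  show ?thesis
  proof (cases "card (S \<inter> {s, t}) = 1")
    case True
    then have "sum x (cut V S) \<ge> 1" using assms(5,7) proper by (simp add: lp_feasible_def)
    then show ?thesis using deg True by simp
  next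
    case False
    then have "even (card (S \<inter> {s, t}))" using card_Int_doubleton[of S s t] by auto
    then have "sum x (cut V S) \<ge> 2" using assms(5,7) proper unfolding lp_feasible_def by blast
    then show ?thesis using deg by simp
  qed
qed

text \<open>The components hold at most their subtour bounds. Subtracting these from the total
  \<open>card V - 1\<close> leaves enough value for the edges between components.\<close>

lemma lp_partition:
  assumes "finite V" "s \<in> V" "t \<in> V" "s \<noteq> t" "lp_feasible V s t x" "Z \<subseteq> complete_edges V"
  shows "real (card (edge_components V Z)) \<le> sum x (crossing V Z) + 1"
proof -
  let ?E = "complete_edges V" and ?P = "edge_components V Z"
  define I where "I C = {e \<in> ?E. e \<subseteq> C}" for C
  have finE: "finite ?E" using assms by simp
  have sub: "C \<subseteq> V" if "C \<in> ?P" for C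
    using that assms(6) unfolding edge_components_def
    by (elim imageE, hypsubst) (intro adj_rtrancl_Image_subset; auto)
  have ne: "C \<noteq> {}" if "C \<in> ?P" for C using that by (auto simp: edge_components_def)
  have disj: "C \<inter> D = {}" if CD: "C \<in> ?P" "D \<in> ?P" "C \<noteq> D" for C D
  proof (rule ccontr)
    assume "C \<inter> D \<noteq> {}"
    then obtain v where v: "v \<in> C" "v \<in> D" by blast
    obtain a b where ab: "C = (adj Z)\<^sup>* `` {a}" "D = (adj Z)\<^sup>* `` {b}"
      using CD by (auto simp: edge_components_def)
    then have "(a, v) \<in> (adj Z)\<^sup>*" "(b, v) \<in> (adj Z)\<^sup>*" using v by auto
    then have "C = D" unfolding ab class_eq_iff[symmetric] by simp
    then show False using CD by simp
  qed
  have "V \<subseteq> \<Union>?P" by (auto simp: edge_components_def)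
  then have UP: "\<Union>?P = V" using sub by blast
  have finC: "finite C" if "C \<in> ?P" for C using sub[OF that] assms(1) finite_subset by blast
  have "card (\<Union>?P) = (\<Sum>C\<in>?P. card C)"
    using finC disj by (intro card_Union_disjoint) (auto simp: pairwise_def disjnt_def)
  then have "(\<Sum>C\<in>?P. card C) = card V" by (simp only: UP)
  have "sum x (\<Union>C\<in>?P. I C) = (\<Sum>C\<in>?P. sum x (I C))"
  proof (rule sum.UNION_disjoint)
    show "\<forall>C\<in>?P. finite (I C)" using finE by (auto simp: I_def)
    show "\<forall>C\<in>?P. \<forall>D\<in>?P. C \<noteq> D \<longrightarrow> I C \<inter> I D = {}"
    proof (intro ballI impI)
      fix C D assume "C \<in> ?P" "D \<in> ?P" "C \<noteq> D"
      then have "C \<inter> D = {}" by (rule disj)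
      then show "I C \<inter> I D = {}" by (auto simp: I_def elim!: complete_edgesE)
    qed
  qed (use assms in simp)
  also have "\<dots> \<le> (\<Sum>C\<in>?P. real (card C) - 1)"
    unfolding I_def by (intro sum_mono lp_sum_inside[OF assms(1-5)] sub ne)
  also have "\<dots> = real (card V) - real (card ?P)"
    using \<open>(\<Sum>C\<in>?P. card C) = card V\<close> by (simp add: sum_subtractf flip: of_nat_sum)
  finally have "sum x (\<Union>C\<in>?P. I C) \<le> real (card V) - real (card ?P)" .
  moreover have "(\<Union>C\<in>?P. I C) = ?E - crossing V Z" by (auto simp: I_def crossing_def)
  moreover have "sum x (?E - crossing V Z) = sum x ?E - sum x (crossing V Z)"
    using finE by (intro sum_diff) (auto simp: crossing_def)
  ultimately show ?thesis using lp_sum_all[OF assms(1-5)] by simp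
qed

section \<open>Feasible solutions as convex combinations of trees\<close>

lemma tree_decomposition_exists:
  assumes "finite V" "s \<in> V" "t \<in> V" "s \<noteq> t" "lp_feasible V s t x"
  shows "\<exists>l lam J. tree_decomposition V x l lam J"
proof -
  let ?E = "complete_edges V"
  \<comment> \<open>Size replaces acyclicity here: connectedness forces equality in the size bound,
    and then the members are spanning trees.\<close>
  define B where "B = {J. J \<subseteq> ?E \<and> connects V J \<and> Suc (card J) \<le> card V}"
  have V: "V \<noteq> {}" using assms by auto
  have finE: "finite ?E" using assms by simp
  have finB: "finite B"
    by (rule finite_subset[of _ "Pow ?E"]) (use finE in \<open>auto simp: B_def\<close>)
  have x0: "x e \<ge> 0" if "e \<in> ?E" for e using assms(5) that unfolding lp_feasible_def by blast
  have cardB: "real (card J) = real (card V) - 1" if "J \<in> B" for J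
  proof -
    have J: "J \<subseteq> ?E" "connects V J" "Suc (card J) \<le> card V" using that by (simp_all add: B_def)
    show ?thesis
      using card_le_components_plus_edges[OF assms(1) J(1)] card_components_connected[OF J(2) V] J(3)
      by simp
  qed
  have "\<exists>J\<in>B. (\<Sum>e\<in>?E. w e * indicator J e) \<le> (\<Sum>e\<in>?E. w e * x e)" for w
  proof -
    \<comment> \<open>Adding \<open>M\<close> makes all weights nonnegative. Each set in
      \<open>B\<close> has \<open>card V - 1\<close> edges and \<open>x\<close> has the same total,
      so both sides grow by the same amount.\<close>
    define M where "M = (\<Sum>e\<in>?E. \<bar>w e\<bar>)"
    have "w e + M \<ge> 0" if "e \<in> ?E" for e
      using member_le_sum[of e ?E "\<lambda>e. \<bar>w e\<bar>"] finE that unfolding M_def by fastforce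
    then obtain J where J: "J \<in> B" "(\<Sum>e\<in>J. w e + M) \<le> (\<Sum>e\<in>?E. (w e + M) * x e)"
      using light_connecting_set[OF assms(1) V x0 lp_partition[OF assms], of "\<lambda>e. w e + M"]
      unfolding B_def by blast
    have "(\<Sum>e\<in>J. w e + M) = sum w J + M * (real (card V) - 1)"
      using cardB[OF J(1)] by (simp add: sum.distrib)
    moreover have "(\<Sum>e\<in>?E. (w e + M) * x e) = (\<Sum>e\<in>?E. w e * x e) + M * (real (card V) - 1)"
      unfolding lp_sum_all[OF assms, symmetric] by (simp add: distrib_right sum.distrib sum_distrib_left)
    moreover have "sum w J = (\<Sum>e\<in>?E. w e * indicator J e)"
      using sum_as_of_bool[OF finE, of J w] J(1) by (simp add: B_def indicator_def of_bool_def)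
    ultimately show ?thesis using J by auto
  qed
  from convex_combination_if_not_separated[OF finE finB this] obtain lam where
    lam: "\<forall>J\<in>B. lam J \<ge> 0" "sum lam B = 1" "\<forall>e\<in>?E. x e = (\<Sum>J\<in>B. lam J * indicator J e)" by blast
  \<comment> \<open>A decomposition requires strictly positive coefficients, so zero terms are
    dropped before the trees are numbered.\<close>
  define B' where "B' = {J \<in> B. lam J > 0}"
  obtain f where f: "bij_betw f {1..card B'} B'"
    using ex_bij_betw_nat_finite_1[of B'] finB by (auto simp: B'_def)
  have reindex: "(\<Sum>i=1..card B'. lam (f i) * h (f i)) = (\<Sum>J\<in>B. lam J * h J)" for h :: "_ \<Rightarrow> real"
  proof -
    have "(\<Sum>i=1..card B'. lam (f i) * h (f i)) = (\<Sum>J\<in>B'. lam J * h J)"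
      by (rule sum.reindex_bij_betw[OF f])
    also have "\<dots> = (\<Sum>J\<in>B. lam J * h J)"
      using finB lam(1) by (intro sum.mono_neutral_left) (force simp: B'_def)+
    finally show ?thesis .
  qed
  have "f i \<in> B'" if "i \<in> {1..card B'}" for i using bij_betwE[OF f] that by blast
  then have "tree_decomposition V x (card B') (\<lambda>i. lam (f i)) f"
    using spanning_tree_if_few_edges[OF assms(1) V] reindex[of "\<lambda>_. 1"] lam(2,3)
      reindex[of "\<lambda>J. indicator J _"]
    by (auto simp: tree_decomposition_def B'_def B_def)
  then show ?thesis by blast
qed

section \<open>Crossings of trees and odd cuts\<close>

lemma connected_crosses_cut:
  assumes "finite V" "K \<subseteq> complete_edges V" "connects V K" "S \<noteq> {}" "S \<subset> V"
  shows "card (K \<inter> cut V S) \<ge> 1"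
proof -
  obtain u v where uv: "u \<in> S" "v \<in> V" "v \<notin> S" using assms by blast
  have "K \<inter> cut V S \<noteq> {}"
  proof
    assume no: "K \<inter> cut V S = {}"
    have "(adj K)\<^sup>* `` {u} \<subseteq> S"
    proof (rule adj_rtrancl_Image_subset[OF _ uv(1)])
      fix a b assume ab: "{a, b} \<in> K" "a \<in> S"
      then have "a \<in> V" "b \<in> V" using subsetD[OF assms(2) ab(1)] by auto
      then show "b \<in> S" using no ab doubleton_in_cut[of a b V S] by blast
    qed
    then show False using uv assms(3,5) unfolding connects_def by blast
  qed
  moreover have "finite K" using assms(1,2) finite_subset finite_complete_edges by metis
  ultimately show ?thesis by (simp add: Suc_le_eq card_gt_0_iff)
qed

text \<open>Linearity of expectation over the sampled tree, used with \<open>f\<close> constantly 1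
  on a cut and with \<open>f = c\<close> on all edges.\<close>

lemma tree_decomposition_sum:
  assumes "finite V" "tree_decomposition V x l lam J" "A \<subseteq> complete_edges V"
  shows "(\<Sum>e\<in>A. f e * x e) = (\<Sum>i=1..l. lam i * sum f (J i \<inter> A))"
proof -
  have finA: "finite A" using assms finite_subset finite_complete_edges by metis
  have "f e * x e = (\<Sum>i=1..l. lam i * (f e * indicator (J i) e))" if "e \<in> A" for e
  proof -
    have "x e = (\<Sum>i=1..l. lam i * indicator (J i) e)"
      using assms(2,3) that unfolding tree_decomposition_def by blast
    then show ?thesis by (simp only: sum_distrib_left mult.left_commute)
  qed
  then have "(\<Sum>e\<in>A. f e * x e) = (\<Sum>e\<in>A. \<Sum>i=1..l. lam i * (f e * indicator (J i) e))"
    by (intro sum.cong) auto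
  also have "\<dots> = (\<Sum>i=1..l. \<Sum>e\<in>A. lam i * (f e * indicator (J i) e))" by (rule sum.swap)
  also have "\<dots> = (\<Sum>i=1..l. lam i * sum f (J i \<inter> A))"
    using finA by (simp add: sum_distrib_left[symmetric] sum.inter_restrict indicator_def if_distrib Int_commute cong: if_cong)
  finally show ?thesis .
qed

text \<open>On an \<open>s\<close>-\<open>t\<close> cut, \<open>x(\<delta>(S)) = 2|S| - 1 - 2x(E(S))\<close>.\<close>

lemma half_integral_st_cut:
  assumes "finite V" "S \<subseteq> V" "lp_feasible V s t x" "half_integral V x" "card (S \<inter> {s, t}) = 1"
  shows "sum x (cut V S) \<in> \<int>"
proof -
  have "2 * x e \<in> \<int>" if "e \<in> complete_edges V" for e
  proof -
    have "2 * x e = 0 \<or> 2 * x e = 1 \<or> 2 * x e = 2"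
      using assms(4) that by (auto simp: half_integral_def)
    then show ?thesis using Ints_0 Ints_1 Ints_numeral by metis
  qed
  then have "2 * sum x {e \<in> complete_edges V. e \<subseteq> S} \<in> \<int>"
    unfolding sum_distrib_left by (intro Ints_sum) auto
  moreover have "sum x (cut V S) = 2 * real (card S) - 1 - 2 * sum x {e \<in> complete_edges V. e \<subseteq> S}"
    using lp_sum_degrees[OF assms(1-3)] assms(5) by simp
  ultimately show ?thesis by simp
qed

text \<open>Tree \<open>i\<close> crosses an \<open>s\<close>-\<open>t\<close> cut of this kind an
  even number of times, hence at least twice, and every other tree at least once. As
  \<open>lam i\<close> is positive, the average exceeds 1, and integrality raises it to 2.\<close>

lemma wrong_degree_odd_cut:
  assumes "finite V" "s \<in> V" "t \<in> V" "s \<noteq> t" "lp_feasible V s t x" "half_integral V x"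
    and dec: "tree_decomposition V x l lam J" and i: "i \<in> {1..l}"
    and S: "S \<subseteq> V" "odd (card (S \<inter> wrong_degree V s t (J i)))"
  shows "sum x (cut V S) \<ge> 2"
proof -
  have tree: "J i \<subseteq> complete_edges V \<and> connects V (J i) \<and> lam i > 0" if "i \<in> {1..l}" for i
    using dec that by (simp add: tree_decomposition_def spanning_tree_def)
  have "S \<noteq> {}" using S by auto
  have "wrong_degree V s t (J i) \<subseteq> V" using assms by (auto simp: wrong_degree_def)
  then have "S \<noteq> V"
    using S even_card_wrong_degree[OF assms(1-4), of "J i"] tree[OF i] by (auto simp: Int_absorb1)
  then have "S \<subset> V" using S by blast
  show ?thesis
  proof (cases "card (S \<inter> {s, t}) = 1")
    case False
    then have "even (card (S \<inter> {s, t}))" using card_Int_doubleton[of S s t] by auto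
    then show ?thesis using assms(5) \<open>S \<noteq> {}\<close> \<open>S \<subset> V\<close> unfolding lp_feasible_def by blast
  next
    case True
    have ge: "real (card (J j \<inter> cut V S)) \<ge> 1" if "j \<in> {1..l}" for j
      using connected_crosses_cut[OF assms(1) _ _ \<open>S \<noteq> {}\<close> \<open>S \<subset> V\<close>, of "J j"] tree[OF that] by simp
    have finS: "finite S" using S assms finite_subset by blast
    define A where "A = {v \<in> V. odd (degree (J i) v)}"
    have "T_join V A (J i)" using tree[OF i] by (simp add: T_join_def A_def)
    moreover have "S \<inter> wrong_degree V s t (J i) = sym_diff (S \<inter> A) (S \<inter> {s, t})"
      unfolding wrong_degree_eq[OF assms(2,3)] A_def by auto
    ultimately have "even (card (J i \<inter> cut V S))"
      using S even_card_sym_diff[of "S \<inter> A" "S \<inter> {s, t}"] finS True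
        T_join_cut_parity[OF assms(1) _ S(1), of A "J i"] by simp
    then have "card (J i \<inter> cut V S) \<noteq> 1" by (metis odd_one)
    then have ne1: "real (card (J i \<inter> cut V S)) > 1" using ge[OF i] by simp
    have "1 = (\<Sum>j=1..l. lam j)" using dec by (simp add: tree_decomposition_def)
    also have "\<dots> < (\<Sum>j=1..l. lam j * real (card (J j \<inter> cut V S)))"
    proof (rule sum_strict_mono_ex1)
      show "\<forall>j\<in>{1..l}. lam j \<le> lam j * real (card (J j \<inter> cut V S))"
      proof
        fix j assume j: "j \<in> {1..l}"
        show "lam j \<le> lam j * real (card (J j \<inter> cut V S))"
          using mult_left_mono[OF ge[OF j], of "lam j"] tree[OF j] by simp
      qed
      show "\<exists>j\<in>{1..l}. lam j < lam j * real (card (J j \<inter> cut V S))"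
        using i tree[OF i] ne1 by (intro bexI[of _ i]) auto
    qed auto
    also have "\<dots> = sum x (cut V S)"
      using tree_decomposition_sum[OF assms(1) dec cut_subset, of "\<lambda>_. 1"] by simp
    finally have gt: "sum x (cut V S) > 1" .
    obtain k :: int where "sum x (cut V S) = of_int k"
      using half_integral_st_cut[OF assms(1) S(1) assms(5,6) True] by (auto elim: Ints_cases)
    moreover from this have "1 < k" using gt by simp
    ultimately show ?thesis by simp
  qed
qed

lemma wrong_degree_join_le:
  assumes "finite V" "s \<in> V" "t \<in> V" "s \<noteq> t" "metric_costs V c" "lp_feasible V s t x" "half_integral V x"
    and "tree_decomposition V x l lam J" "i \<in> {1..l}"
    and "min_cost_T_join V c (wrong_degree V s t (J i)) F"
  shows "sum c F \<le> fractional_cost V c x / 2"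
proof -
  have "J i \<subseteq> complete_edges V"
    using assms(8,9) by (simp add: tree_decomposition_def spanning_tree_def)
  then have "sum c F \<le> (\<Sum>e\<in>complete_edges V. c e * (x e / 2))"
    using assms wrong_degree_odd_cut[OF assms(1-4,6-9)] even_card_wrong_degree[OF assms(1-4)]
    by (intro min_T_join_le[where T = "wrong_degree V s t (J i)"])
      (auto simp: wrong_degree_def metric_costs_def lp_feasible_def simp flip: sum_divide_distrib)
  then show ?thesis by (simp add: fractional_cost_def sum_divide_distrib)
qed

section \<open>Expected cost of the output\<close>

text \<open>Several indices may yield the same path, so the weights are collected per path and the
  sum is then regrouped by index.\<close>

lemma expectation_pmf_of_list:
  fixes f :: "'b \<Rightarrow> real" and P :: "nat \<Rightarrow> 'b" and lam :: "nat \<Rightarrow> real"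
  assumes "\<And>i. i \<in> {1..l} \<Longrightarrow> lam i > 0" "(\<Sum>i=1..l. lam i) = 1"
  defines "Q \<equiv> pmf_of_list (map (\<lambda>i. (P i, lam i)) [1..<Suc l])"
  shows "set_pmf Q = P ` {1..l}" "measure_pmf.expectation Q f = (\<Sum>i=1..l. lam i * f (P i))"
proof -
  let ?xs = "map (\<lambda>i. (P i, lam i)) [1..<Suc l]"
  have I: "set [1..<Suc l] = {1..l}" by auto
  have "sum_list (map lam [1..<Suc l]) = (\<Sum>i=1..l. lam i)"
    by (simp only: sum_list_distinct_conv_sum_set distinct_upt I)
  then have wf: "pmf_of_list_wf ?xs"
    using assms(1,2) by (auto simp: pmf_of_list_wf_def o_def less_imp_le I simp del: upt_Suc)
  then show set: "set_pmf Q = P ` {1..l}"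
    unfolding Q_def using assms(1) by (subst set_pmf_of_list_eq) (auto simp: image_image I simp del: upt_Suc)
  have pmf: "pmf Q a = sum lam {i \<in> {1..l}. P i = a}" for a
  proof -
    have "pmf Q a = sum_list (map lam (filter (\<lambda>i. P i = a) [1..<Suc l]))"
      unfolding Q_def pmf_pmf_of_list[OF wf] by (simp add: filter_map o_def del: upt_Suc)
    also have "\<dots> = sum lam (set (filter (\<lambda>i. P i = a) [1..<Suc l]))"
      by (intro sum_list_distinct_conv_sum_set distinct_filter distinct_upt)
    also have "set (filter (\<lambda>i. P i = a) [1..<Suc l]) = {i \<in> {1..l}. P i = a}" by auto
    finally show ?thesis .
  qed
  have "measure_pmf.expectation Q f = (\<Sum>a\<in>P ` {1..l}. f a * pmf Q a)"
    by (rule integral_measure_pmf_real) (auto simp: set)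
  also have "\<dots> = (\<Sum>a\<in>P ` {1..l}. \<Sum>i\<in>{i \<in> {1..l}. P i = a}. lam i * f (P i))"
    unfolding pmf sum_distrib_left by (intro sum.cong) auto
  also have "\<dots> = (\<Sum>i=1..l. lam i * f (P i))"
    by (rule sum.group) auto
  finally show "measure_pmf.expectation Q f = (\<Sum>i=1..l. lam i * f (P i))" .
qed

theorem theorem4:
  fixes V :: "'a set" and c x :: "'a set \<Rightarrow> real" and s t :: 'a
  assumes "finite V" and "s \<in> V" and "t \<in> V" and "s \<noteq> t"
    and "metric_costs V c"
    and "lp_feasible V s t x" and "half_integral V x"
  shows "(\<exists>Q. randomized_christofides V c s t x Q) \<and>
    (\<forall>Q. randomized_christofides V c s t x Q \<longrightarrow>
       (\<forall>P\<in>set_pmf Q. hamiltonian_path V s t P) \<and>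
       measure_pmf.expectation Q (path_cost c) \<le> 3/2 * fractional_cost V c x)"
proof (intro conjI allI impI)
  obtain l lam J where dec: "tree_decomposition V x l lam J"
    using tree_decomposition_exists[OF assms(1-4,6)] by blast
  have "\<forall>i\<in>{1..l}. \<exists>P. christofides_path V c s t (J i) P"
  proof
    fix i assume "i \<in> {1..l}"
    then have "J i \<subseteq> complete_edges V" "connects V (J i)"
      using dec by (simp_all add: tree_decomposition_def spanning_tree_def)
    then show "\<exists>P. christofides_path V c s t (J i) P"
      by (rule christofides_path_exists[OF assms(1-4)])
  qed
  then obtain P where "\<forall>i\<in>{1..l}. christofides_path V c s t (J i) (P i)"
    by (auto dest!: bchoice)
  then show "\<exists>Q. randomized_christofides V c s t x Q"
    using dec unfolding randomized_christofides_def by blast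
next
  fix Q assume "randomized_christofides V c s t x Q"
  then obtain l lam J P where dec: "tree_decomposition V x l lam J"
    and P: "\<And>i. i \<in> {1..l} \<Longrightarrow> christofides_path V c s t (J i) (P i)"
    and Q: "Q = pmf_of_list (map (\<lambda>i. (P i, lam i)) [1..<Suc l])"
    unfolding randomized_christofides_def by blast
  have lam: "\<And>i. i \<in> {1..l} \<Longrightarrow> lam i > 0" "(\<Sum>i=1..l. lam i) = 1"
    and tree: "\<And>i. i \<in> {1..l} \<Longrightarrow> J i \<subseteq> complete_edges V" "\<And>i. i \<in> {1..l} \<Longrightarrow> connects V (J i)"
    using dec by (simp_all add: tree_decomposition_def spanning_tree_def)
  note ham = christofides_path_hamiltonian[OF assms(1-5) tree P]
  have set: "set_pmf Q = P ` {1..l}"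
    unfolding Q using lam by (rule expectation_pmf_of_list(1))
  have exp: "measure_pmf.expectation Q (path_cost c) = (\<Sum>i=1..l. lam i * path_cost c (P i))"
    unfolding Q using lam by (rule expectation_pmf_of_list(2))
  show "\<forall>P\<in>set_pmf Q. hamiltonian_path V s t P"
    unfolding set using ham(1) by blast
  have cost: "path_cost c (P i) \<le> sum c (J i) + fractional_cost V c x / 2" if i: "i \<in> {1..l}" for i
    using ham(2)[OF i i i] wrong_degree_join_le[OF assms dec i] by fastforce
  have "measure_pmf.expectation Q (path_cost c)
      \<le> (\<Sum>i=1..l. lam i * (sum c (J i) + fractional_cost V c x / 2))"
    unfolding exp using lam(1) by (intro sum_mono mult_left_mono cost) (auto simp: less_imp_le)
  also have "\<dots> = (\<Sum>i=1..l. lam i * sum c (J i)) + (\<Sum>i=1..l. lam i) * (fractional_cost V c x / 2)"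
    by (simp only: distrib_left sum.distrib sum_distrib_right)
  also have "(\<Sum>i=1..l. lam i * sum c (J i)) = fractional_cost V c x"
    unfolding fractional_cost_def tree_decomposition_sum[OF assms(1) dec order_refl]
    using tree(1) by (intro sum.cong) (auto simp: Int_absorb2)
  finally show "measure_pmf.expectation Q (path_cost c) \<le> 3/2 * fractional_cost V c x"
    using lam(2) by simp
qed

end
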